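(* Let $\Omega\subset\mathbb{R}^n$ be a domain and let $F=F(A,p,s,x)\in C^2(\mathrm{Sym}(n)\times\mathbb{R}^n\times\mathbb{R}\times\Omega)$ be a real-valued function. Suppose there exists a continuous function $\eta>0$ on $\Omega$ such that for every $(A,p,s,x)\in\mathrm{Sym}^+(n)\times\mathbb{R}^n\times\mathbb{R}\times\Omega$, every symmetric matrix $(X_{ab})\in\mathrm{Sym}(n)$, every vector $(Z_a)\in\mathbb{R}^n$ and every $Y\in\mathbb{R}$, $$\begin{aligned} \eta(x)\,|X|^2\le{}& F^{ab,rs}X_{ab}X_{rs}+2F^{ar}A^{bs}X_{ab}X_{rs}+F^{x_a,x_b}Z_aZ_b\\ &-2F^{ab,s}X_{ab}Y-2F^{ab,x_r}X_{ab}Z_r+2F^{s,x_a}YZ_a+F^{s,s}Y^2, \end{aligned}$$ where the derivatives of $F$ are evaluated at $(A,p,s,x)$ (here, as a superscript after a comma or in $F^{s,x_a}$, $F^{s,s}$, the letter $s$ standing alone denotes differentiation in the scalar variable, whereas in $F^{ab,rs}$, $A^{bs}$, $X_{rs}$ it is a summation index). Let $u\in C^3(\Omega)$ be a convex solution of $$F(D^2u,Du,u,x)=0\quad\text{on }\Omega,$$ subject to the ellipticity condition $F^{ij}(D^2u,Du,u,x)>0$ on $\Omega$. Let $n-k$ be the rank of $D^2u$ (which is constant on $\Omega$). Then there exist $k$ fixed directions, i.e. $k$ linearly independent constant vectors $X_1,\ldots,X_k\in\mathbb{R}^n$, such that $(D^2u(x))(X_j)=0$ for all $1\le j\le k$ and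 all $x\in\Omega$.
   Context: $\mathrm{Sym}(n)$ is the space of real symmetric $n\times n$ matrices and $\mathrm{Sym}^+(n)$ is the subset of strictly positive definite ones. A domain is a connected open set. Repeated indices are summed from $1$ to $n$. $A^{ij}$ denotes the $(i,j)$th entry of $A^{-1}$, and $|X|^2=\sum_{a,b}X_{ab}^2$. $F^{ij}$ denotes the derivative of $F$ with respect to the $(i,j)$th entry $A_{ij}$ of $A$, with the usual convention that $F^{ij}X_{ij}$ is the derivative of $F$ in the direction $X\in\mathrm{Sym}(n)$, and $F^{ab,rs}X_{ab}X_{rs}$ is the corresponding second derivative in the direction $X$. $F^{ab,s}$, $F^{ab,x_r}$, $F^{s,x_a}$, $F^{s,s}$, $F^{x_a,x_b}$ (with $s$ alone denoting the scalar variable) are the mixed and second partial derivatives of $F$ in the matrix entries, the scalar variable and the coordinates $x_a$. $F^{ij}>0$ means that the symmetric matrix $(F^{ij})$ is positive definite at each point of $\Omega$. The inequality assumed on $F$ with $\eta|X|^2$ replaced by $0$ is equivalent to local convexity of $(A,s,x)\mapsto F(A^{-1},p,s,x)$ on $\mathrm{Sym}^+(n)\times\mathbb{R}\times\Omega$ for each $p$; under it $D^2u$ has constant rank in $\Omega$. *)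

theory Defs
  imports "HOL-Analysis.Analysis"
begin

text \<open>
  \<open>f\<close> is of class \<open>C\<^sup>k\<close> on \<open>S\<close>. For open \<open>S\<close> this is the usual notion. The theorem also uses it
  with \<open>S\<close> relatively open in a proper linear subspace (symmetric matrices inside all matrices):
  the derivative is taken within \<open>S\<close>, so only increments in that subspace matter, and the values
  of \<open>f' z h\<close> at other \<open>h\<close> can be chosen freely (e.g. by composing with a projection), so that
  quantifying over all \<open>h\<close> is no restriction. Values of \<open>f\<close> outside \<open>S\<close> are irrelevant.
\<close>

primrec Ck_on :: "nat \<Rightarrow> ('a::real_normed_vector \<Rightarrow> real) \<Rightarrow> 'a set \<Rightarrow> bool" where
  "Ck_on 0 f S \<longleftrightarrow> continuous_on S f"
| "Ck_on (Suc k) f S \<longleftrightarrow>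
     (\<exists>f'. (\<forall>z\<in>S. (f has_derivative f' z) (at z within S)) \<and> (\<forall>h. Ck_on k (\<lambda>z. f' z h) S))"

definition dir_deriv :: "'a::real_normed_vector \<Rightarrow> ('a \<Rightarrow> real) \<Rightarrow> 'a \<Rightarrow> real" where
  "dir_deriv h f z = deriv (\<lambda>t. f (z + t *\<^sub>R h)) 0"

definition gradient :: "(real^'n \<Rightarrow> real) \<Rightarrow> real^'n \<Rightarrow> real^'n" where
  "gradient u x = (\<chi> i. dir_deriv (axis i 1) u x)"

definition hessian :: "(real^'n \<Rightarrow> real) \<Rightarrow> real^'n \<Rightarrow> real^'n^'n" where
  "hessian u x = (\<chi> i j. dir_deriv (axis i 1) (dir_deriv (axis j 1) u) x)"

definition Sym :: "(real^'n^'n) set" where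
  "Sym = {A. transpose A = A}"

definition Sym_pos :: "(real^'n^'n) set" where
  "Sym_pos = {A \<in> Sym. \<forall>v. v \<noteq> 0 \<longrightarrow> v \<bullet> (A *v v) > 0}"

text \<open>
  The library's \<^const>\<open>convex_on\<close> entails convexity of the domain, which is not assumed here; a
  function on an open set is convex if it is convex on every convex subset (equivalently, along
  every line segment contained in the set).
\<close>

definition convex_fun_on :: "(real^'n) set \<Rightarrow> (real^'n \<Rightarrow> real) \<Rightarrow> bool" where
  "convex_fun_on \<Omega> u \<longleftrightarrow> (\<forall>C. convex C \<and> C \<subseteq> \<Omega> \<longrightarrow> convex_on C u)"

text \<open>The arguments \<open>(A, p, s, x)\<close> of \<open>F\<close>.\<close>

type_synonym 'n jet = "(real^'n^'n) \<times> (real^'n) \<times> real \<times> (real^'n)"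

definition jet_domain :: "(real^'n) set \<Rightarrow> 'n jet set" where
  "jet_domain \<Omega> = Sym \<times> UNIV \<times> UNIV \<times> \<Omega>"

text \<open>
  The entries \<open>A\<^sub>i\<^sub>j\<close> and \<open>A\<^sub>j\<^sub>i\<close> of a symmetric matrix are not independent. With \<open>E\<^sub>i\<^sub>j\<close> the matrix
  units, differentiating in the direction \<open>(E\<^sub>i\<^sub>j + E\<^sub>j\<^sub>i) / 2\<close> gives the symmetric matrix
  \<open>F\<^sup>i\<^sup>j\<close> for which \<open>\<Sum>\<^sub>i\<^sub>j F\<^sup>i\<^sup>j X\<^sub>i\<^sub>j\<close> is the derivative of \<open>F\<close> in the direction of
  a symmetric \<open>X\<close>; similarly for second derivatives.
\<close>

definition D_mat :: "'n \<Rightarrow> 'n \<Rightarrow> ('n::finite jet \<Rightarrow> real) \<Rightarrow> 'n jet \<Rightarrow> real" where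
  "D_mat i j = dir_deriv ((1/2) *\<^sub>R (axis i (axis j 1) + axis j (axis i 1)), 0, 0, 0)"

definition D_scal :: "('n::finite jet \<Rightarrow> real) \<Rightarrow> 'n jet \<Rightarrow> real" where
  "D_scal = dir_deriv (0, 0, 1, 0)"

definition D_pos :: "'n \<Rightarrow> ('n::finite jet \<Rightarrow> real) \<Rightarrow> 'n jet \<Rightarrow> real" where
  "D_pos a = dir_deriv (0, 0, 0, axis a 1)"

end

theory Submission
  imports Defs
begin

text \<open>
  Let \<open>H(x)\<close> be the Hessian of \<open>u\<close>, \<open>N(x)\<close> its kernel, of constant dimension \<open>k\<close>, and for a vector \<open>v\<close>
  let \<open>D\<^sub>v H\<close> be the derivative of \<open>H\<close> in the direction \<open>v\<close>. The heart of the proof is that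
  \<open>D\<^sub>v H(x) = 0\<close> whenever \<open>v \<in> N(x)\<close> (\<open>hessian_deriv_kernel_zero\<close>). Once this is known, for a fixed vector
  \<open>v \<in> N(x\<^sub>0)\<close> the function \<open>x \<mapsto> H(x) v\<close> satisfies a linear differential inequality along every short
  segment from \<open>x\<^sub>0\<close> and vanishes at \<open>x\<^sub>0\<close>, hence vanishes near \<open>x\<^sub>0\<close>. So \<open>N\<close> is locally constant, and
  therefore constant on the connected set \<open>\<Omega>\<close>.

  If \<open>u\<close> had four derivatives, one would differentiate the equation twice in the direction \<open>v\<close> and
  use \<open>D\<^sub>v D\<^sub>v H = 2 X H\<^sup>+ X\<close> with \<open>X = D\<^sub>v H\<close> and \<open>H\<^sup>+\<close> the pseudoinverse; this produces the right hand side
  of the structural inequality at \<open>A = H\<close>, with \<open>H\<^sup>+\<close> in place of \<open>A\<^sup>-\<^sup>1\<close>. For \<open>u\<close> of class \<open>C\<^sup>3\<close> the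
  missing fourth derivatives are obtained from the geometry of the null directions:

  \<^item> Since \<open>u\<close> is convex, \<open>v \<bullet> H v\<close> has a minimum where it vanishes, so \<open>(D\<^sub>v H) w = 0\<close> for \<open>v, w \<in> N(x)\<close>
    (\<open>hessian_deriv_null\<close>).

  \<^item> Together with the constant rank this shows that straight lines in null directions stay null and
    that the gradient is constant on them (\<open>flat_leaf\<close>).

  \<^item> Let \<open>v \<in> N(x\<^sub>0)\<close> and \<open>X = D\<^sub>v H(x\<^sub>0)\<close>, let \<open>P\<close> be the orthogonal projection onto \<open>N(x\<^sub>0)\<close> and \<open>K\<close> the inverse
    of \<open>H(x\<^sub>0) + P\<close>. Comparing the gradients on neighbouring lines gives the exact formula
    \<open>H(x\<^sub>0 + t v) (1 - t K X) = H(x\<^sub>0)\<close> (\<open>leaf_hessian\<close>). Thus \<open>t \<mapsto> H(x\<^sub>0 + t v)\<close> has second derivative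
    \<open>2 X K X\<close> at \<open>0\<close>, although \<open>u\<close> need not have fourth derivatives (\<open>leaf_hessian_second_order\<close>).

  Differentiating the equation twice along the line \<open>x\<^sub>0 + t v\<close> is therefore legitimate and gives an
  identity (\<open>equation_along_leaf\<close>). The structural inequality is then applied at the positive definite
  matrices \<open>H(x\<^sub>0) + \<epsilon> P\<close>: the inverses of these blow up as \<open>\<epsilon>\<close> tends to \<open>0\<close>, but only on \<open>N(x\<^sub>0)\<close>, which \<open>X\<close>
  annihilates. In the limit the right hand side is the left hand side of the identity, which is zero, so that
  \<open>\<eta>(x\<^sub>0) \<bar>X\<bar>\<^sup>2 \<le> 0\<close>.
\<close>

section \<open>Directional derivatives on relatively open sets\<close>

text \<open>
  Two situations are treated at once: \<open>u\<close> lives on an open set, while \<open>F\<close> lives on a set which is open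
  only relative to the symmetric matrices. What directional derivatives need is that small
  increments within a subspace \<open>T\<close> of admissible directions stay in the set.
\<close>

definition open_along :: "'a::real_normed_vector set \<Rightarrow> 'a set \<Rightarrow> bool" where
  "open_along T S \<longleftrightarrow> subspace T \<and> (\<forall>z\<in>S. \<exists>e>0. \<forall>h\<in>T. norm h < e \<longrightarrow> z + h \<in> S)"

lemma open_along_UNIV: "open S \<Longrightarrow> open_along UNIV S"
  unfolding open_along_def
proof (intro conjI ballI)
  fix z assume "open S" "z \<in> S"
  then obtain e where "e > 0" "\<forall>y. dist y z < e \<longrightarrow> y \<in> S" by (auto simp: open_dist)
  then show "\<exists>e>0. \<forall>h\<in>UNIV. norm h < e \<longrightarrow> z + h \<in> S"
    by (intro exI[of _ e]) (simp add: dist_norm)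
qed auto

lemma has_derivative_along_line:
  assumes S: "open_along T S" "z \<in> S" "h \<in> T"
    and f: "(f has_derivative f') (at z within S)"
  shows "((\<lambda>t. f (z + t *\<^sub>R h)) has_real_derivative f' h) (at 0)"
proof -
  from S obtain e where e: "e > 0" "\<And>h. h \<in> T \<Longrightarrow> norm h < e \<Longrightarrow> z + h \<in> S" and T: "subspace T"
    unfolding open_along_def by blast
  define I where "I = {t::real. norm (t *\<^sub>R h) < e}"
  have opI: "open I" unfolding I_def by (intro open_Collect_less continuous_intros)
  have 0: "0 \<in> I" using e by (simp add: I_def)
  have sub: "(\<lambda>t. z + t *\<^sub>R h) ` I \<subseteq> S"
    using e S(3) T by (auto simp: I_def subspace_scale)
  interpret f': bounded_linear f' using f by (rule has_derivative_bounded_linear)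
  have "((\<lambda>t. f (z + t *\<^sub>R h)) has_derivative (\<lambda>t. f' (t *\<^sub>R h))) (at 0 within I)"
  proof (rule has_derivative_in_compose[where f = "\<lambda>t. z + t *\<^sub>R h"])
    show "((\<lambda>t. z + t *\<^sub>R h) has_derivative (\<lambda>t. t *\<^sub>R h)) (at 0 within I)"
      by (auto intro!: derivative_eq_intros)
    show "(f has_derivative f') (at (z + 0 *\<^sub>R h) within (\<lambda>t. z + t *\<^sub>R h) ` I)"
      using has_derivative_subset[OF f sub] by simp
  qed
  moreover have "(\<lambda>t. f' (t *\<^sub>R h)) = (*) (f' h)"
    by (rule ext) (simp add: f'.scaleR)
  ultimately show ?thesis
    unfolding has_field_derivative_def at_within_open[OF 0 opI] by simp
qed

lemma dir_deriv_eq: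
  assumes "open_along T S" "z \<in> S" "h \<in> T" "(f has_derivative f') (at z within S)"
  shows "dir_deriv h f z = f' h"
  unfolding dir_deriv_def by (rule DERIV_imp_deriv[OF has_derivative_along_line[OF assms]])

lemma Ck_on_cong:
  assumes "\<And>z. z \<in> S \<Longrightarrow> f z = g z" "Ck_on k f S" shows "Ck_on k g S"
  using assms
proof (cases k)
  case 0 then show ?thesis using assms by (simp cong: continuous_on_cong)
next
  case (Suc m)
  with assms(2) obtain f' where f': "\<And>z. z\<in>S \<Longrightarrow> (f has_derivative f' z) (at z within S)"
    "\<And>h. Ck_on m (\<lambda>z. f' z h) S" by auto
  have "(g has_derivative f' z) (at z within S)" if "z \<in> S" for z
    by (rule has_derivative_transform[OF that _ f'(1)[OF that]]) (simp add: assms(1))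
  with f' Suc show ?thesis by auto
qed

lemma Ck_on_SucD: "Ck_on (Suc k) f S \<Longrightarrow> Ck_on k f S"
proof (induction k arbitrary: f)
  case 0 then show ?case by (auto intro: has_derivative_continuous_on)
next
  case (Suc k)
  from Suc.prems obtain f' where f': "\<forall>z\<in>S. (f has_derivative f' z) (at z within S)"
    "\<forall>h. Ck_on (Suc k) (\<lambda>z. f' z h) S" unfolding Ck_on.simps(2)[of "Suc k"] by blast
  then have "\<forall>h. Ck_on k (\<lambda>z. f' z h) S" using Suc.IH by blast
  with f'(1) show ?case unfolding Ck_on.simps(2)[of k] by blast
qed

lemma Ck_on_Suc_derivative:
  assumes "open_along T S" "Ck_on (Suc k) f S" "z \<in> S"
  shows "\<exists>f'. (f has_derivative f') (at z within S) \<and> (\<forall>h\<in>T. dir_deriv h f z = f' h)"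
proof -
  from assms(2,3) obtain f' where f': "(f has_derivative f' z) (at z within S)" by auto
  show ?thesis
    by (intro exI[of _ "f' z"] conjI f' ballI dir_deriv_eq[OF assms(1,3) _ f'])
qed

lemma Ck_on_dir_deriv:
  assumes "open_along T S" "Ck_on (Suc k) f S" "h \<in> T"
  shows "Ck_on k (dir_deriv h f) S"
proof -
  obtain f' where f': "\<And>z. z\<in>S \<Longrightarrow> (f has_derivative f' z) (at z within S)"
    "Ck_on k (\<lambda>z. f' z h) S" using assms(2) by auto
  show ?thesis
    by (rule Ck_on_cong[OF _ f'(2)]) (simp add: dir_deriv_eq[OF assms(1) _ assms(3) f'(1)])
qed

lemma dir_deriv_sum:
  assumes S: "open_along T S" "Ck_on (Suc k) f S" "z \<in> S" and h: "\<And>i. i \<in> I \<Longrightarrow> h i \<in> T"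
  shows "dir_deriv (\<Sum>i\<in>I. c i *\<^sub>R h i) f z = (\<Sum>i\<in>I. c i * dir_deriv (h i) f z)"
proof -
  obtain f' where f': "(f has_derivative f') (at z within S)" "\<forall>h\<in>T. dir_deriv h f z = f' h"
    using Ck_on_Suc_derivative[OF S] by blast
  interpret f': bounded_linear f' using f'(1) by (rule has_derivative_bounded_linear)
  have T: "subspace T" using S by (simp add: open_along_def)
  have "(\<Sum>i\<in>I. c i *\<^sub>R h i) \<in> T" using h T by (intro subspace_sum subspace_scale)
  then show ?thesis using h by (simp add: f'(2) f'.sum f'.scaleR)
qed

lemma dir_deriv_add:
  assumes S: "open_along T S" "Ck_on (Suc k) f S" "z \<in> S" and h: "g \<in> T" "h \<in> T"
  shows "dir_deriv (g + h) f z = dir_deriv g f z + dir_deriv h f z"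
proof -
  obtain f' where f': "(f has_derivative f') (at z within S)" "\<forall>h\<in>T. dir_deriv h f z = f' h"
    using Ck_on_Suc_derivative[OF S] by blast
  interpret f': bounded_linear f' using f'(1) by (rule has_derivative_bounded_linear)
  have T: "subspace T" using S by (simp add: open_along_def)
  then show ?thesis using h by (simp add: f'(2) f'.add subspace_add)
qed

lemma has_real_derivative_along_curve:
  assumes S: "open_along T S" "Ck_on (Suc k) f S"
    and g: "(g has_vector_derivative d) (at t)" "d \<in> T" and inS: "\<forall>\<^sub>F s in nhds t. g s \<in> S"
  shows "((\<lambda>t. f (g t)) has_real_derivative dir_deriv d f (g t)) (at t)"
proof -
  obtain I where I: "open I" "t \<in> I" "\<And>s. s \<in> I \<Longrightarrow> g s \<in> S"
    using inS unfolding eventually_nhds by blast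
  obtain f' where f': "(f has_derivative f') (at (g t) within S)" "\<forall>h\<in>T. dir_deriv h f (g t) = f' h"
    using Ck_on_Suc_derivative[OF S I(3)[OF I(2)]] by blast
  interpret f': bounded_linear f' using f'(1) by (rule has_derivative_bounded_linear)
  have "((\<lambda>t. f (g t)) has_derivative (\<lambda>h. f' (h *\<^sub>R d))) (at t within I)"
  proof (rule has_derivative_in_compose[where f = g and g = f and g' = f'])
    show "(g has_derivative (\<lambda>h. h *\<^sub>R d)) (at t within I)"
      using g(1) unfolding has_vector_derivative_def by (rule has_derivative_at_withinI)
    show "(f has_derivative f') (at (g t) within g ` I)"
      by (rule has_derivative_subset[OF f'(1)]) (use I in auto)
  qed
  moreover have "(\<lambda>h. f' (h *\<^sub>R d)) = (*) (dir_deriv d f (g t))"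
    by (rule ext) (simp add: f'.scaleR f'(2) g(2))
  ultimately show ?thesis
    unfolding has_field_derivative_def at_within_open[OF I(2,1)] by simp
qed

lemma has_real_derivative_along_line:
  assumes S: "open_along T S" "Ck_on (Suc k) f S" and h: "h \<in> T" "z + t *\<^sub>R h \<in> S"
  shows "((\<lambda>t. f (z + t *\<^sub>R h)) has_real_derivative dir_deriv h f (z + t *\<^sub>R h)) (at t)"
proof (rule has_real_derivative_along_curve[OF S _ h(1)])
  show "((\<lambda>t. z + t *\<^sub>R h) has_vector_derivative h) (at t)"
    by (auto intro!: derivative_eq_intros)
  from S(1) h(2) obtain e where e: "e > 0" "\<And>g. g \<in> T \<Longrightarrow> norm g < e \<Longrightarrow> z + t *\<^sub>R h + g \<in> S"
    and T: "subspace T" unfolding open_along_def by blast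
  have "((\<lambda>s. norm ((s - t) *\<^sub>R h)) \<longlongrightarrow> norm ((t - t) *\<^sub>R h)) (nhds t)"
    by (intro tendsto_intros filterlim_ident)
  then have "\<forall>\<^sub>F s in nhds t. norm ((s - t) *\<^sub>R h) < e"
    by (rule order_tendstoD) (simp add: e)
  then show "\<forall>\<^sub>F s in nhds t. z + s *\<^sub>R h \<in> S"
  proof eventually_elim
    case (elim s)
    have "z + t *\<^sub>R h + (s - t) *\<^sub>R h \<in> S" using elim T h(1) by (intro e(2) subspace_scale)
    then show ?case by (simp add: algebra_simps)
  qed
qed

text \<open>
  The mean value theorem, applied first in direction \<open>h\<close> and then in direction \<open>k\<close>, turns the second
  difference over a parallelogram into a mixed derivative at an intermediate point. The second difference is
  symmetric in \<open>h\<close> and \<open>k\<close>, which is what makes the two mixed derivatives agree in the limit.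
\<close>

lemma second_difference_mean_value:
  assumes S: "open_along T S" and f: "Ck_on 2 f S" and h: "h \<in> T" "k \<in> T" and r: "r > 0"
    and sub: "\<And>s t. 0 \<le> s \<Longrightarrow> s \<le> r \<Longrightarrow> 0 \<le> t \<Longrightarrow> t \<le> r \<Longrightarrow> z + s *\<^sub>R h + t *\<^sub>R k \<in> S"
  shows "\<exists>s t. 0 \<le> s \<and> s \<le> r \<and> 0 \<le> t \<and> t \<le> r \<and>
    f (z + r *\<^sub>R h + r *\<^sub>R k) - f (z + r *\<^sub>R h) - f (z + r *\<^sub>R k) + f z
      = r * r * dir_deriv k (dir_deriv h f) (z + s *\<^sub>R h + t *\<^sub>R k)"
proof -
  have f2: "Ck_on (Suc 1) f S" using f by (simp add: numeral_2_eq_2)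
  have f1: "Ck_on (Suc 0) (dir_deriv h f) S" using Ck_on_dir_deriv[OF S f2 h(1)] by simp
  define g where "g s = f (z + r *\<^sub>R k + s *\<^sub>R h) - f (z + s *\<^sub>R h)" for s
  have sub1: "z + s *\<^sub>R h \<in> S" if "0 \<le> s" "s \<le> r" for s
    using sub[of s 0] that r by simp
  have sub2: "z + r *\<^sub>R k + s *\<^sub>R h \<in> S" if "0 \<le> s" "s \<le> r" for s
    using sub[of s r] that r by (simp add: algebra_simps)
  have "\<exists>s. s > 0 \<and> s < r \<and> g r - g 0 =
    (r - 0) * (dir_deriv h f (z + r *\<^sub>R k + s *\<^sub>R h) - dir_deriv h f (z + s *\<^sub>R h))"
    unfolding g_def
    by (rule MVT2[OF r]) (intro DERIV_diff has_real_derivative_along_line[OF S f2 h(1)] sub1 sub2; assumption)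
  then obtain s where s: "0 < s" "s < r" and gs: "g r - g 0 =
    r * (dir_deriv h f (z + s *\<^sub>R h + r *\<^sub>R k) - dir_deriv h f (z + s *\<^sub>R h))"
    by (auto simp: algebra_simps)
  have "\<exists>t. t > 0 \<and> t < r \<and>
    dir_deriv h f (z + s *\<^sub>R h + r *\<^sub>R k) - dir_deriv h f (z + s *\<^sub>R h + 0 *\<^sub>R k) =
    (r - 0) * dir_deriv k (dir_deriv h f) (z + s *\<^sub>R h + t *\<^sub>R k)"
    by (rule MVT2[OF r]) (use s in \<open>intro has_real_derivative_along_line[OF S f1 h(2)] sub; simp\<close>)
  then obtain t where "0 < t" "t < r"
    "dir_deriv h f (z + s *\<^sub>R h + r *\<^sub>R k) - dir_deriv h f (z + s *\<^sub>R h) =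
    r * dir_deriv k (dir_deriv h f) (z + s *\<^sub>R h + t *\<^sub>R k)" by auto
  with gs s show ?thesis
    by (intro exI[of _ s] exI[of _ t]) (auto simp: g_def algebra_simps)
qed

text \<open>
  Needed to rewrite below an outer derivative: an identity between functions that holds on \<open>S\<close> only
  may be differentiated, because the line in direction \<open>h\<close> stays in \<open>S\<close> for a short time.
\<close>

lemma dir_deriv_cong:
  assumes S: "open_along T S" "Ck_on (Suc k) f S" "z \<in> S" "h \<in> T"
    and fg: "\<And>z. z \<in> S \<Longrightarrow> f z = g z"
  shows "dir_deriv h f z = dir_deriv h g z"
proof -
  obtain f' where f': "(f has_derivative f') (at z within S)" using S(2,3) by auto
  have "(g has_derivative f') (at z within S)"
    by (rule has_derivative_transform[OF S(3) _ f']) (simp add: fg)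
  then show ?thesis using dir_deriv_eq[OF S(1,3,4)] f' by metis
qed

text \<open>
  Schwarz's theorem. Both mixed derivatives are continuous and equal the same second difference quotient
  at nearby points, so a gap between them at \<open>z\<close> contradicts continuity.
\<close>

lemma dir_deriv_commute:
  assumes S: "open_along T S" and f: "Ck_on 2 f S" and h: "h \<in> T" "k \<in> T" and z: "z \<in> S"
  shows "dir_deriv h (dir_deriv k f) z = dir_deriv k (dir_deriv h f) z"
proof (rule ccontr)
  let ?a = "dir_deriv h (dir_deriv k f)" and ?b = "dir_deriv k (dir_deriv h f)"
  assume ne: "?a z \<noteq> ?b z"
  have f2: "Ck_on (Suc (Suc 0)) f S" using f by (simp add: numeral_2_eq_2)
  have ca: "continuous_on S ?a"
    using Ck_on_dir_deriv[OF S Ck_on_dir_deriv[OF S f2 h(2)] h(1)] by simp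
  have cb: "continuous_on S ?b"
    using Ck_on_dir_deriv[OF S Ck_on_dir_deriv[OF S f2 h(1)] h(2)] by simp
  define \<epsilon> where "\<epsilon> = \<bar>?a z - ?b z\<bar> / 2"
  have \<epsilon>: "\<epsilon> > 0" using ne by (simp add: \<epsilon>_def)
  obtain da where da: "da > 0" "\<And>y. y \<in> S \<Longrightarrow> dist y z < da \<Longrightarrow> dist (?a y) (?a z) < \<epsilon>"
    using ca z \<epsilon> unfolding continuous_on_iff by blast
  obtain db where db: "db > 0" "\<And>y. y \<in> S \<Longrightarrow> dist y z < db \<Longrightarrow> dist (?b y) (?b z) < \<epsilon>"
    using cb z \<epsilon> unfolding continuous_on_iff by blast
  from S z obtain e where e: "e > 0" "\<And>h. h \<in> T \<Longrightarrow> norm h < e \<Longrightarrow> z + h \<in> S" and T: "subspace T"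
    unfolding open_along_def by blast
  define d where "d = min e (min da db)"
  have d: "d > 0" using e da db by (simp add: d_def)
  \<comment> \<open>The side \<open>r\<close> keeps the whole parallelogram within distance \<open>d\<close> of \<open>z\<close>.\<close>
  define r where "r = d / (2 * (norm h + norm k + 1))"
  have r: "r > 0" using d by (simp add: r_def add_nonneg_pos)
  have rd: "r * (norm h + norm k) < d"
  proof -
    have n0: "2 * (norm h + norm k + 1) \<noteq> 0" by (smt (verit) norm_ge_zero)
    have "2 * (r * (norm h + norm k)) \<le> r * (2 * (norm h + norm k + 1))" using r by (simp add: algebra_simps)
    also have "\<dots> = d" using n0 by (metis nonzero_eq_divide_eq r_def)
    finally show ?thesis using d by linarith
  qed
  have small: "norm (s *\<^sub>R h + t *\<^sub>R k) < d" if "0 \<le> s" "s \<le> r" "0 \<le> t" "t \<le> r" for s t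
  proof -
    have "norm (s *\<^sub>R h + t *\<^sub>R k) \<le> s * norm h + t * norm k"
      using norm_triangle_ineq[of "s *\<^sub>R h" "t *\<^sub>R k"] that by simp
    also have "\<dots> \<le> r * norm h + r * norm k" using that by (intro add_mono mult_right_mono) auto
    finally show ?thesis using rd by (simp add: algebra_simps)
  qed
  have sub: "z + s *\<^sub>R h + t *\<^sub>R k \<in> S" if "0 \<le> s" "s \<le> r" "0 \<le> t" "t \<le> r" for s t
    using e(2)[of "s *\<^sub>R h + t *\<^sub>R k"] small[OF that] h T
    by (simp add: d_def subspace_add subspace_scale add.assoc)
  obtain s t where st: "0 \<le> s" "s \<le> r" "0 \<le> t" "t \<le> r" and
    1: "f (z + r *\<^sub>R h + r *\<^sub>R k) - f (z + r *\<^sub>R h) - f (z + r *\<^sub>R k) + f z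
      = r * r * ?b (z + s *\<^sub>R h + t *\<^sub>R k)"
    using second_difference_mean_value[OF S f h r sub] by blast
  have sub': "z + s *\<^sub>R k + t *\<^sub>R h \<in> S" if "0 \<le> s" "s \<le> r" "0 \<le> t" "t \<le> r" for s t
    using sub[OF that(3,4,1,2)] by (simp add: algebra_simps)
  obtain s' t' where st': "0 \<le> s'" "s' \<le> r" "0 \<le> t'" "t' \<le> r" and
    2: "f (z + r *\<^sub>R k + r *\<^sub>R h) - f (z + r *\<^sub>R k) - f (z + r *\<^sub>R h) + f z
      = r * r * ?a (z + s' *\<^sub>R k + t' *\<^sub>R h)"
    using second_difference_mean_value[OF S f h(2,1) r sub'] by blast
  have "r * r * ?b (z + s *\<^sub>R h + t *\<^sub>R k) = r * r * ?a (z + s' *\<^sub>R k + t' *\<^sub>R h)"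
    using 1 2 by (simp add: algebra_simps)
  then have eq: "?b (z + s *\<^sub>R h + t *\<^sub>R k) = ?a (z + s' *\<^sub>R k + t' *\<^sub>R h)" using r by simp
  have "dist (?b (z + s *\<^sub>R h + t *\<^sub>R k)) (?b z) < \<epsilon>"
    using small[OF st] by (intro db sub st) (simp add: dist_norm d_def add.assoc)
  moreover have "dist (?a (z + s' *\<^sub>R k + t' *\<^sub>R h)) (?a z) < \<epsilon>"
    using small[OF st'(3,4,1,2)] by (intro da sub' st') (simp add: dist_norm d_def algebra_simps)
  ultimately show False unfolding eq dist_real_def \<epsilon>_def by (smt (verit) field_sum_of_halves)
qed

section \<open>The Hessian and its derivative\<close>

lemma bounded_bilinear_matrix_vector_mult:
  "bounded_bilinear ((*v) :: real^'n^'m \<Rightarrow> real^'n \<Rightarrow> real^'m)"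
  unfolding bilinear_conv_bounded_bilinear[symmetric] bilinear_def
  by (auto intro!: linearI simp: algebra_simps scaleR_matrix_vector_assoc[symmetric])

lemma bounded_bilinear_matrix_matrix_mult:
  "bounded_bilinear ((**) :: real^'n^'m \<Rightarrow> real^'k^'n \<Rightarrow> real^'k^'m)"
  unfolding bilinear_conv_bounded_bilinear[symmetric] bilinear_def
  by (auto intro!: linearI simp: matrix_add_ldistrib vec_eq_iff matrix_matrix_mult_def sum.distrib sum_distrib_left algebra_simps)

lemmas matrix_mult_bilinear =
  bounded_bilinear.add_left[OF bounded_bilinear_matrix_matrix_mult]
  bounded_bilinear.add_right[OF bounded_bilinear_matrix_matrix_mult]
  bounded_bilinear.diff_left[OF bounded_bilinear_matrix_matrix_mult]
  bounded_bilinear.diff_right[OF bounded_bilinear_matrix_matrix_mult]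
  bounded_bilinear.minus_right[OF bounded_bilinear_matrix_matrix_mult]
  bounded_bilinear.scaleR_left[OF bounded_bilinear_matrix_matrix_mult]
  bounded_bilinear.scaleR_right[OF bounded_bilinear_matrix_matrix_mult]

lemma vec_axis_sum: "(v::real^'n) = (\<Sum>i\<in>UNIV. v $ i *\<^sub>R axis i 1)"
  using basis_expansion[of v] by (simp add: scalar_mult_eq_scaleR)

lemma inner_matrix_vector: "v \<bullet> (A *v w) = (\<Sum>i\<in>UNIV. v $ i * (\<Sum>j\<in>UNIV. w $ j * A $ i $ j))"
  for A :: "real^'n^'m"
  by (simp add: inner_vec_def matrix_vector_mult_def mult.commute)

lemma Sym_iff: "A \<in> Sym \<longleftrightarrow> (\<forall>i j. A $ i $ j = A $ j $ i)"
  by (auto simp: Sym_def transpose_def vec_eq_iff)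

lemma Sym_inner: "A \<in> Sym \<Longrightarrow> v \<bullet> (A *v w) = (A *v v) \<bullet> w"
  unfolding Sym_def by (metis (mono_tags, lifting) dot_lmul_matrix mem_Collect_eq transpose_matrix_vector)

lemma has_derivative_vec_iff:
  fixes f :: "'a::real_normed_vector \<Rightarrow> ('b::euclidean_space)^'n"
  shows "(f has_derivative f') (at a within S) \<longleftrightarrow>
    (\<forall>i. ((\<lambda>x. f x $ i) has_derivative (\<lambda>x. f' x $ i)) (at a within S))"
proof
  assume "(f has_derivative f') (at a within S)"
  then show "\<forall>i. ((\<lambda>x. f x $ i) has_derivative (\<lambda>x. f' x $ i)) (at a within S)"
    using bounded_linear.has_derivative[OF bounded_linear_vec_nth] by blast
next
  assume R: "\<forall>i. ((\<lambda>x. f x $ i) has_derivative (\<lambda>x. f' x $ i)) (at a within S)"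
  show "(f has_derivative f') (at a within S)"
    unfolding has_derivative_componentwise_within[of f]
  proof
    fix b :: "'b^'n" assume "b \<in> Basis"
    then obtain i c where b: "b = axis i c" by (auto simp: Basis_vec_def)
    show "((\<lambda>x. f x \<bullet> b) has_derivative (\<lambda>x. f' x \<bullet> b)) (at a within S)"
      unfolding b inner_axis using R by (intro has_derivative_inner_left) auto
  qed
qed

lemma has_vector_derivative_compose:
  assumes "(g has_vector_derivative g') (at s)" "(f has_derivative f') (at (g s))"
  shows "((\<lambda>s. f (g s)) has_vector_derivative f' g') (at s)"
proof -
  have "((\<lambda>s. f (g s)) has_derivative (\<lambda>h. f' (h *\<^sub>R g'))) (at s)"
    using has_derivative_compose assms unfolding has_vector_derivative_def by blast
  moreover have "f' (h *\<^sub>R g') = h *\<^sub>R f' g'" for h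
    using has_derivative_bounded_linear[OF assms(2)] by (simp add: linear_simps)
  ultimately show ?thesis by (simp add: has_vector_derivative_def)
qed

definition hessian_deriv :: "(real^'n \<Rightarrow> real) \<Rightarrow> real^'n \<Rightarrow> real^'n \<Rightarrow> real^'n^'n" where
  "hessian_deriv u x v = (\<chi> i j. dir_deriv v (dir_deriv (axis i 1) (dir_deriv (axis j 1) u)) x)"

locale C3_function =
  fixes \<Omega> :: "(real^'n) set" and u :: "real^'n \<Rightarrow> real"
  assumes open_\<Omega>: "open \<Omega>" and C3: "Ck_on 3 u \<Omega>"
begin

lemmas along = open_along_UNIV[OF open_\<Omega>]

lemma Ck_u: "Ck_on (Suc (Suc (Suc 0))) u \<Omega>" "Ck_on (Suc (Suc 0)) u \<Omega>" "Ck_on 2 u \<Omega>"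
  using C3 Ck_on_SucD[of 2 u \<Omega>] unfolding numeral_3_eq_3 numeral_2_eq_2 by (auto simp del: Ck_on.simps)

lemma Ck_du: "Ck_on (Suc (Suc 0)) (dir_deriv a u) \<Omega>" "Ck_on 2 (dir_deriv a u) \<Omega>"
  using Ck_on_dir_deriv[OF along Ck_u(1), of a] unfolding numeral_2_eq_2 by simp_all

lemma Ck_ddu: "Ck_on (Suc 0) (dir_deriv a (dir_deriv b u)) \<Omega>"
  using Ck_on_dir_deriv[OF along Ck_du(1), of a] by simp

lemma dir_deriv_expand:
  assumes "Ck_on (Suc k) f \<Omega>" "x \<in> \<Omega>"
  shows "dir_deriv v f x = (\<Sum>i\<in>UNIV. v $ i * dir_deriv (axis i 1) f x)"
  by (subst vec_axis_sum) (rule dir_deriv_sum[OF along assms]; simp)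

lemma gradient_inner: "x \<in> \<Omega> \<Longrightarrow> dir_deriv v u x = gradient u x \<bullet> v"
  using dir_deriv_expand[OF Ck_u(1), of x v] by (simp add: gradient_def inner_vec_def mult.commute)

lemma hessian_inner:
  assumes x: "x \<in> \<Omega>" shows "dir_deriv v (dir_deriv w u) x = v \<bullet> (hessian u x *v w)"
proof -
  have "dir_deriv v (dir_deriv w u) x = (\<Sum>i\<in>UNIV. v $ i * dir_deriv w (dir_deriv (axis i 1) u) x)"
    unfolding dir_deriv_expand[OF Ck_du(1) x, of v]
    by (intro sum.cong refl arg_cong2[where f="(*)"] dir_deriv_commute[OF along Ck_u(3) _ _ x]) auto
  also have "\<dots> = (\<Sum>i\<in>UNIV. v $ i * (\<Sum>j\<in>UNIV. w $ j * dir_deriv (axis i 1) (dir_deriv (axis j 1) u) x))"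
    unfolding dir_deriv_expand[OF Ck_du(1) x, of w]
    by (intro sum.cong refl arg_cong2[where f="(*)"] dir_deriv_commute[OF along Ck_u(3) _ _ x]) auto
  finally show ?thesis by (simp add: inner_matrix_vector hessian_def)
qed

lemma hessian_Sym: "x \<in> \<Omega> \<Longrightarrow> hessian u x \<in> Sym"
  unfolding Sym_iff hessian_def using dir_deriv_commute[OF along Ck_u(3)] by simp

lemma third_dir_deriv_swap_outer: "x \<in> \<Omega> \<Longrightarrow>
   dir_deriv v (dir_deriv a (dir_deriv b u)) x = dir_deriv a (dir_deriv v (dir_deriv b u)) x"
  by (rule dir_deriv_commute[OF along Ck_du(2)]) auto

lemma third_dir_deriv_swap_inner: "x \<in> \<Omega> \<Longrightarrow>
   dir_deriv v (dir_deriv a (dir_deriv b u)) x = dir_deriv v (dir_deriv b (dir_deriv a u)) x"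
  by (rule dir_deriv_cong[OF along Ck_ddu]) (auto intro: dir_deriv_commute[OF along Ck_u(3)])

text \<open>
  Together with the two preceding lemmas this says that \<open>a \<bullet> (hessian_deriv u x v *v b)\<close> is a
  symmetric trilinear form in \<open>v\<close>, \<open>a\<close>, \<open>b\<close>.
\<close>

lemma hessian_deriv_inner:
  assumes x: "x \<in> \<Omega>"
  shows "dir_deriv v (dir_deriv a (dir_deriv b u)) x = a \<bullet> (hessian_deriv u x v *v b)"
proof -
  have "dir_deriv v (dir_deriv a (dir_deriv b u)) x =
      (\<Sum>i\<in>UNIV. a $ i * dir_deriv (axis i 1) (dir_deriv v (dir_deriv b u)) x)"
    unfolding third_dir_deriv_swap_outer[OF x, of v a] by (rule dir_deriv_expand[OF Ck_ddu x])
  also have "\<dots> = (\<Sum>i\<in>UNIV. a $ i * dir_deriv b (dir_deriv v (dir_deriv (axis i 1) u)) x)"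
    by (metis (no_types, lifting) x third_dir_deriv_swap_outer third_dir_deriv_swap_inner)
  also have "\<dots> = (\<Sum>i\<in>UNIV. a $ i * (\<Sum>j\<in>UNIV. b $ j *
      dir_deriv (axis j 1) (dir_deriv v (dir_deriv (axis i 1) u)) x))"
    unfolding dir_deriv_expand[OF Ck_ddu x, of b] ..
  also have "\<dots> = (\<Sum>i\<in>UNIV. a $ i * (\<Sum>j\<in>UNIV. b $ j *
      dir_deriv v (dir_deriv (axis i 1) (dir_deriv (axis j 1) u)) x))"
  proof -
    have "dir_deriv (axis j 1) (dir_deriv v (dir_deriv (axis i 1) u)) x
        = dir_deriv v (dir_deriv (axis i 1) (dir_deriv (axis j 1) u)) x" for i j
      using third_dir_deriv_swap_outer[OF x] third_dir_deriv_swap_inner[OF x] by metis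
    then show ?thesis by (simp only:)
  qed
  finally show ?thesis by (simp add: inner_matrix_vector hessian_deriv_def)
qed

lemma hessian_deriv_Sym: "x \<in> \<Omega> \<Longrightarrow> hessian_deriv u x v \<in> Sym"
  unfolding Sym_iff hessian_deriv_def using third_dir_deriv_swap_inner by simp

lemma hessian_deriv_commute:
  assumes x: "x \<in> \<Omega>" shows "hessian_deriv u x v *v w = hessian_deriv u x w *v v"
proof (rule vector_eq_rdot[THEN iffD1], rule allI)
  fix z
  have "z \<bullet> (hessian_deriv u x v *v w) = z \<bullet> (hessian_deriv u x w *v v)"
    unfolding hessian_deriv_inner[OF x, symmetric] by (metis x third_dir_deriv_swap_outer third_dir_deriv_swap_inner)
  then show "(hessian_deriv u x v *v w) \<bullet> z = (hessian_deriv u x w *v v) \<bullet> z" by (simp add: inner_commute)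
qed

lemma hessian_deriv_expand: "x \<in> \<Omega> \<Longrightarrow> hessian_deriv u x v = (\<Sum>i\<in>UNIV. v $ i *\<^sub>R hessian_deriv u x (axis i 1))"
  by (simp add: vec_eq_iff hessian_deriv_def sum_component dir_deriv_expand[OF Ck_ddu, of _ v])

lemma hessian_deriv_add: "x \<in> \<Omega> \<Longrightarrow> hessian_deriv u x (v + w) = hessian_deriv u x v + hessian_deriv u x w"
  by (subst (1 2 3) hessian_deriv_expand) (auto simp: scaleR_left_distrib sum.distrib)

lemma hessian_deriv_scale: "x \<in> \<Omega> \<Longrightarrow> hessian_deriv u x (c *\<^sub>R v) = c *\<^sub>R hessian_deriv u x v"
  by (subst (1 2) hessian_deriv_expand) (auto simp: scaleR_sum_right)

lemma hessian_deriv_diff: "x \<in> \<Omega> \<Longrightarrow> hessian_deriv u x (v - w) = hessian_deriv u x v - hessian_deriv u x w"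
  using hessian_deriv_add[of x v "-w"] hessian_deriv_scale[of x "-1" w] by simp

lemma hessian_deriv_continuous: "continuous_on \<Omega> (\<lambda>x. hessian_deriv u x v)"
  unfolding hessian_deriv_def using Ck_on_dir_deriv[OF along Ck_ddu, of v]
  by (intro continuous_on_vec_lambda) simp

lemma has_derivative_hessian:
  assumes x: "x \<in> \<Omega>" shows "(hessian u has_derivative hessian_deriv u x) (at x)"
  unfolding has_derivative_vec_iff
proof (intro allI)
  fix i j
  obtain f' where f': "(dir_deriv (axis i 1) (dir_deriv (axis j 1) u) has_derivative f') (at x within \<Omega>)"
    "\<forall>h\<in>UNIV. dir_deriv h (dir_deriv (axis i 1) (dir_deriv (axis j 1) u)) x = f' h"
    using Ck_on_Suc_derivative[OF along Ck_ddu x] by blast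
  have "f' = (\<lambda>h. hessian_deriv u x h $ i $ j)" using f'(2) by (auto simp: hessian_deriv_def)
  with f'(1) show "((\<lambda>x. hessian u x $ i $ j) has_derivative (\<lambda>h. hessian_deriv u x h $ i $ j)) (at x)"
    unfolding at_within_open[OF x open_\<Omega>] by (simp add: hessian_def)
qed

lemma has_derivative_gradient:
  assumes x: "x \<in> \<Omega>" shows "(gradient u has_derivative (\<lambda>h. hessian u x *v h)) (at x)"
  unfolding has_derivative_vec_iff
proof (intro allI)
  fix j
  obtain f' where f': "(dir_deriv (axis j 1) u has_derivative f') (at x within \<Omega>)"
    "\<forall>h\<in>UNIV. dir_deriv h (dir_deriv (axis j 1) u) x = f' h"
    using Ck_on_Suc_derivative[OF along Ck_du(1) x] by blast
  have "f' = (\<lambda>h. (hessian u x *v h) $ j)"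
    using f'(2) by (auto simp: hessian_inner[OF x] Sym_inner[OF hessian_Sym[OF x]] fun_eq_iff inner_axis)
  with f'(1) show "((\<lambda>x. gradient u x $ j) has_derivative (\<lambda>h. (hessian u x *v h) $ j)) (at x)"
    unfolding at_within_open[OF x open_\<Omega>] by (simp add: gradient_def)
qed

lemma has_derivative_u:
  assumes x: "x \<in> \<Omega>" shows "(u has_derivative (\<lambda>h. gradient u x \<bullet> h)) (at x)"
proof -
  obtain f' where f': "(u has_derivative f') (at x within \<Omega>)"
    "\<forall>h\<in>UNIV. dir_deriv h u x = f' h"
    using Ck_on_Suc_derivative[OF along Ck_u(1) x] by blast
  have "f' = (\<lambda>h. gradient u x \<bullet> h)" using f'(2) gradient_inner[OF x] by auto
  with f'(1) show ?thesis unfolding at_within_open[OF x open_\<Omega>] by simp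
qed

lemma along_line:
  assumes f: "\<And>x. x \<in> \<Omega> \<Longrightarrow> (f has_derivative f' x) (at x)" and x: "x + t *\<^sub>R v \<in> \<Omega>"
  shows "((\<lambda>t. f (x + t *\<^sub>R v)) has_vector_derivative f' (x + t *\<^sub>R v) v) (at t)"
  by (rule has_vector_derivative_compose[where g = "\<lambda>t. x + t *\<^sub>R v", OF _ f[OF x]]) (auto intro!: derivative_eq_intros)

lemma hessian_along_line:
  "x + t *\<^sub>R v \<in> \<Omega> \<Longrightarrow>
    ((\<lambda>t. hessian u (x + t *\<^sub>R v)) has_vector_derivative hessian_deriv u (x + t *\<^sub>R v) v) (at t)"
  by (rule along_line[OF has_derivative_hessian])

lemma gradient_along_line:
  "x + t *\<^sub>R v \<in> \<Omega> \<Longrightarrow>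
    ((\<lambda>t. gradient u (x + t *\<^sub>R v)) has_vector_derivative hessian u (x + t *\<^sub>R v) *v v) (at t)"
  by (rule along_line[OF has_derivative_gradient])

lemma u_along_line:
  "x + t *\<^sub>R v \<in> \<Omega> \<Longrightarrow>
    ((\<lambda>t. u (x + t *\<^sub>R v)) has_vector_derivative gradient u (x + t *\<^sub>R v) \<bullet> v) (at t)"
  by (rule along_line[OF has_derivative_u])

lemma hessian_continuous: "continuous_on \<Omega> (hessian u)"
  using has_derivative_hessian has_derivative_at_withinI has_derivative_continuous_on by blast

lemma hessian_mult_bounded_locally:
  assumes K: "compact K" "K \<subseteq> \<Omega>"
  shows "\<exists>b. \<forall>x\<in>K. norm (hessian u x *v v) \<le> b"
proof -
  have "bounded ((\<lambda>x. hessian u x *v v) ` K)"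
    by (intro compact_imp_bounded compact_continuous_image K(1)
        bounded_linear.continuous_on[OF bounded_bilinear.bounded_linear_left[OF bounded_bilinear_matrix_vector_mult]]
        continuous_on_subset[OF hessian_continuous K(2)])
  then show ?thesis unfolding bounded_iff by blast
qed

lemma hessian_deriv_bounded_locally:
  assumes K: "compact K" "K \<subseteq> \<Omega>"
  shows "\<exists>C>0. \<forall>x\<in>K. \<forall>v w. norm (hessian_deriv u x v *v w) \<le> C * norm v * norm w"
proof -
  obtain D where D: "D > 0" "\<And>(A::real^'n^'n) (w::real^'n). norm (A *v w) \<le> norm A * norm w * D"
    using bounded_bilinear.pos_bounded[OF bounded_bilinear_matrix_vector_mult] by blast
  have "\<exists>B. \<forall>x\<in>K. norm (hessian_deriv u x (axis i 1)) \<le> B" for i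
    using compact_imp_bounded[OF compact_continuous_image[OF continuous_on_subset[OF hessian_deriv_continuous K(2)] K(1)]]
    by (auto simp: bounded_iff)
  then obtain B where B: "\<And>i x. x \<in> K \<Longrightarrow> norm (hessian_deriv u x (axis i 1)) \<le> B i" by metis
  define C where "C = (\<Sum>i\<in>UNIV. \<bar>B i\<bar>)"
  have bd: "norm (hessian_deriv u x v) \<le> C * norm v" if x: "x \<in> K" for x v
  proof -
    have "norm (hessian_deriv u x v) \<le> (\<Sum>i\<in>UNIV. norm (v $ i *\<^sub>R hessian_deriv u x (axis i 1)))"
      using K x by (subst hessian_deriv_expand) (auto simp del: norm_scaleR intro: norm_sum)
    also have "\<dots> \<le> (\<Sum>i\<in>UNIV. \<bar>B i\<bar> * norm v)"
    proof (rule sum_mono)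
      fix i
      have "norm (hessian_deriv u x (axis i 1)) \<le> \<bar>B i\<bar>" using B[OF x, of i] by linarith
      then show "norm (v $ i *\<^sub>R hessian_deriv u x (axis i 1)) \<le> \<bar>B i\<bar> * norm v"
        using component_le_norm_cart[of v i] by (simp add: mult.commute mult_mono)
    qed
    finally show ?thesis by (simp add: C_def sum_distrib_right)
  qed
  have C0: "C \<ge> 0" by (simp add: C_def sum_nonneg)
  have "norm (hessian_deriv u x v *v w) \<le> (C * D + 1) * norm v * norm w" if x: "x \<in> K" for x v w
  proof -
    have "norm (hessian_deriv u x v *v w) \<le> norm (hessian_deriv u x v) * norm w * D" by (rule D)
    also have "\<dots> \<le> (C * norm v) * norm w * D"
      using bd[OF x, of v] D(1) by (intro mult_right_mono) auto
    also have "\<dots> \<le> (C * D + 1) * norm v * norm w" by (simp add: algebra_simps)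
    finally show ?thesis .
  qed
  moreover have "C * D + 1 > 0" using C0 D by (simp add: add_nonneg_pos)
  ultimately show ?thesis by blast
qed

end

section \<open>Kernels of positive semidefinite matrices\<close>

lemma Sym_add: "A \<in> Sym \<Longrightarrow> B \<in> Sym \<Longrightarrow> A + B \<in> Sym" by (simp add: Sym_iff)
lemma Sym_scaleR: "A \<in> Sym \<Longrightarrow> c *\<^sub>R A \<in> Sym" by (simp add: Sym_iff)

lemma Sym_kernel_projection:
  fixes A :: "real^'n^'n"
  shows "\<exists>P\<in>Sym. A ** P = 0 \<and> P ** P = P \<and> (\<forall>v. A *v v = 0 \<longrightarrow> P *v v = v)"
proof -
  define S where "S = {v. A *v v = 0}"
  have S: "subspace S" unfolding S_def
    by (auto simp: subspace_def matrix_vector_right_distrib matrix_vector_mult_scaleR)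
  obtain B where B: "B \<subseteq> S" "pairwise orthogonal B" "\<And>x. x \<in> B \<Longrightarrow> norm x = 1"
    "independent B" "span B = S"
    using orthonormal_basis_subspace[OF S] by metis
  have fin: "finite B" using B(4) by (rule independent_imp_finite)
  define P :: "real^'n^'n" where "P = (\<chi> i j. \<Sum>b\<in>B. b $ i * b $ j)"
  have Pv: "P *v v = (\<Sum>b\<in>B. (v \<bullet> b) *\<^sub>R b)" for v
  proof (rule vec_eq_iff[THEN iffD2], rule allI)
    fix i
    have "(P *v v) $ i = (\<Sum>j\<in>UNIV. \<Sum>b\<in>B. b $ i * b $ j * v $ j)"
      by (simp add: P_def matrix_vector_mult_def sum_distrib_right)
    also have "\<dots> = (\<Sum>b\<in>B. \<Sum>j\<in>UNIV. b $ i * b $ j * v $ j)" by (rule sum.swap)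
    also have "\<dots> = (\<Sum>b\<in>B. (v \<bullet> b) *\<^sub>R b) $ i"
      by (simp add: sum_component inner_vec_def sum_distrib_left sum_distrib_right mult_ac)
    finally show "(P *v v) $ i = (\<Sum>b\<in>B. (v \<bullet> b) *\<^sub>R b) $ i" .
  qed
  have PS: "P *v v \<in> S" for v
    unfolding Pv using B(1) S by (intro subspace_sum subspace_scale) auto
  have id: "P *v v = v" if "v \<in> S" for v
    unfolding Pv using orthonormal_basis_expand[OF B(2,3) _ fin] that B(5) by auto
  have "P \<in> Sym" by (simp add: Sym_iff P_def mult.commute)
  moreover have "A ** P = 0"
    using PS by (simp add: matrix_eq matrix_vector_mul_assoc[symmetric] S_def)
  moreover have "P ** P = P"
    using PS id by (simp add: matrix_eq matrix_vector_mul_assoc[symmetric])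
  ultimately show ?thesis using id by (auto simp: S_def)
qed

text \<open>
  If \<open>w = A v\<close> were nonzero, moving from \<open>v\<close> a little in direction \<open>- w\<close> would make the form negative, since
  the first order term \<open>2 t \<bar>w\<bar>\<^sup>2\<close> dominates.
\<close>

lemma nonneg_form_null:
  assumes A: "A \<in> Sym" and nonneg: "\<And>v. v \<bullet> (A *v v) \<ge> 0" and v: "v \<bullet> (A *v v) = 0"
  shows "A *v v = 0"
proof (rule ccontr)
  assume ne: "A *v v \<noteq> 0"
  define w where "w = A *v v"
  define q where "q = w \<bullet> (A *v w)"
  have q: "q \<ge> 0" unfolding q_def by (rule nonneg)
  \<comment> \<open>With \<open>q + 1\<close> in place of \<open>q\<close> the denominator is positive even if \<open>q = 0\<close>.\<close>
  define t where "t = - (w \<bullet> w) / (q + 1)"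
  have "0 \<le> (v + t *\<^sub>R w) \<bullet> (A *v (v + t *\<^sub>R w))" by (rule nonneg)
  also have "\<dots> = 2 * t * (w \<bullet> w) + t * t * q"
    using v Sym_inner[OF A, of v w]
    by (simp add: matrix_vector_right_distrib matrix_vector_mult_scaleR inner_add_left inner_add_right
        w_def[symmetric] q_def inner_commute algebra_simps)
  also have "\<dots> \<le> 2 * t * (w \<bullet> w) + t * t * (q + 1)" by (simp add: algebra_simps)
  also have "t * t * (q + 1) = - t * (w \<bullet> w)" using q by (simp add: t_def)
  finally have "0 \<le> t * (w \<bullet> w)" by simp
  moreover have "t < 0" "w \<bullet> w > 0" using ne q by (simp_all add: t_def w_def divide_neg_pos)
  ultimately show False by (simp add: zero_le_mult_iff)
qed

lemma matrix_inv_unique: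
  fixes A :: "real^'n^'n"
  assumes "A ** B = mat 1" "B ** A = mat 1" shows "matrix_inv A = B"
proof -
  have "A ** matrix_inv A = mat 1 \<and> matrix_inv A ** A = mat 1"
    unfolding matrix_inv_def by (rule someI[of _ B]) (use assms in simp)
  then show ?thesis using assms by (metis matrix_mul_assoc matrix_mul_lid matrix_mul_rid)
qed

text \<open>
  \<open>P\<close> is the orthogonal projection onto the kernel of a symmetric matrix \<open>A\<close>, and \<open>K\<close> acts as the inverse of
  \<open>A\<close> on the range of \<open>A\<close> and as the identity on its kernel; so \<open>K - P\<close> is the pseudoinverse of \<open>A\<close>. Unlike
  the pseudoinverse, \<open>K\<close> is the inverse of a matrix and can be cancelled.
\<close>

definition kernel_split :: "real^'n^'n \<Rightarrow> real^'n^'n \<Rightarrow> real^'n^'n \<Rightarrow> bool" where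
  "kernel_split A P K \<longleftrightarrow> P \<in> Sym \<and> A ** P = 0 \<and> P ** A = 0 \<and> P ** P = P \<and>
     (\<forall>v. A *v v = 0 \<longrightarrow> P *v v = v) \<and> K ** (A + P) = mat 1 \<and> (A + P) ** K = mat 1"

lemma kernel_split_exists:
  fixes A :: "real^'n^'n"
  assumes A: "A \<in> Sym" shows "\<exists>P K. kernel_split A P K"
proof -
  obtain P where P: "P \<in> Sym" "A ** P = 0" "P ** P = P" "\<And>v. A *v v = 0 \<Longrightarrow> P *v v = v"
    using Sym_kernel_projection[of A] by blast
  have PA: "P ** A = 0"
  proof -
    have "transpose (A ** P) = P ** A" using A P(1) by (simp add: matrix_transpose_mul Sym_def)
    then show ?thesis using P(2) by (simp add: transpose_def vec_eq_iff)
  qed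
  have "v = 0" if v: "(A + P) *v v = 0" for v
  proof -
    have "P *v ((A + P) *v v) = (P ** A + P ** P) *v v"
      by (simp only: matrix_vector_mul_assoc matrix_add_ldistrib)
    then have Pv: "P *v v = 0" using v PA P(3) by simp
    then have "A *v v = 0" using v by (simp add: matrix_vector_mult_add_rdistrib)
    then show ?thesis using P(4) Pv by metis
  qed
  then obtain K where K: "K ** (A + P) = mat 1"
    using matrix_left_invertible_ker[of "A + P"] by blast
  then have "(A + P) ** K = mat 1" by (simp add: matrix_left_right_inverse)
  then show ?thesis using P PA K unfolding kernel_split_def by blast
qed

text \<open>
  The singular part of the inverse of \<open>A + \<epsilon> P\<close> is a multiple of \<open>P\<close>, so it disappears when multiplied
  with a matrix that annihilates the kernel of \<open>A\<close>.
\<close>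

lemma kernel_split_inverse:
  fixes A :: "real^'n^'n"
  assumes A: "A \<in> Sym" and nonneg: "\<And>v. v \<bullet> (A *v v) \<ge> 0" and PK: "kernel_split A P K" and \<epsilon>: "\<epsilon> > 0"
  shows "A + \<epsilon> *\<^sub>R P \<in> Sym_pos" "matrix_inv (A + \<epsilon> *\<^sub>R P) = K + (1 / \<epsilon> - 1) *\<^sub>R P"
proof -
  note P = PK[unfolded kernel_split_def]
  have "v \<bullet> ((A + \<epsilon> *\<^sub>R P) *v v) > 0" if "v \<noteq> 0" for v
  proof -
    have Pv: "v \<bullet> (P *v v) = (P *v v) \<bullet> (P *v v)"
      using P Sym_inner[of P v "P *v v"] by (metis matrix_vector_mul_assoc)
    have "\<not> (v \<bullet> (A *v v) = 0 \<and> v \<bullet> (P *v v) = 0)"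
      using nonneg_form_null[OF A nonneg] P that Pv by (metis inner_eq_zero_iff)
    moreover have "v \<bullet> (P *v v) \<ge> 0" by (simp add: Pv)
    ultimately have "v \<bullet> (A *v v) + \<epsilon> * (v \<bullet> (P *v v)) > 0"
      using nonneg[of v] \<epsilon> by (smt (verit) mult_pos_pos zero_le_mult_iff)
    then show ?thesis
      by (simp add: matrix_vector_mult_add_rdistrib scaleR_matrix_vector_assoc[symmetric] inner_add_right)
  qed
  moreover have "A + \<epsilon> *\<^sub>R P \<in> Sym" using A P by (intro Sym_add Sym_scaleR) auto
  ultimately show "A + \<epsilon> *\<^sub>R P \<in> Sym_pos" by (simp add: Sym_pos_def)
  have KP: "K ** P = P"
  proof -
    have "K ** ((A + P) ** P) = P" using P by (simp add: matrix_mul_assoc)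
    then show ?thesis using P by (simp add: matrix_mult_bilinear)
  qed
  have PK: "P ** K = P"
  proof -
    have "(P ** (A + P)) ** K = P" using P by (simp add: matrix_mul_assoc[symmetric])
    then show ?thesis using P by (simp add: matrix_mult_bilinear)
  qed
  have "A ** K + P = mat 1" using P PK by (simp add: matrix_mult_bilinear)
  moreover have "K ** A + P = mat 1" using P KP by (simp add: matrix_mult_bilinear)
  moreover define c where "c = 1 / \<epsilon> - 1"
  moreover have "\<epsilon> *\<^sub>R P + (\<epsilon> * c) *\<^sub>R P = P"
    using \<epsilon> by (simp add: c_def scaleR_add_left[symmetric] algebra_simps)
  ultimately show "matrix_inv (A + \<epsilon> *\<^sub>R P) = K + (1 / \<epsilon> - 1) *\<^sub>R P"
    using P KP PK by (intro matrix_inv_unique) (simp_all add: matrix_mult_bilinear add.assoc c_def[symmetric] scaleR_add_right mult.commute)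
qed

section \<open>Convex functions with Hessian of constant rank\<close>

text \<open>
  A homogeneous form of Gronwall's inequality: \<open>exp (- 2 C t) \<bar>f t\<bar>\<^sup>2\<close> is nonincreasing, nonnegative and
  vanishes at \<open>0\<close>.
\<close>

lemma vanishes_of_derivative_bound:
  fixes f :: "real \<Rightarrow> 'a::real_inner"
  assumes der: "\<And>t. 0 \<le> t \<Longrightarrow> t \<le> 1 \<Longrightarrow> (f has_vector_derivative f' t) (at t)"
    and bound: "\<And>t. 0 \<le> t \<Longrightarrow> t \<le> 1 \<Longrightarrow> norm (f' t) \<le> C * norm (f t)"
    and f0: "f 0 = 0" and t: "0 \<le> t" "t \<le> 1"
  shows "f t = 0"
proof -
  define \<phi> where "\<phi> s = exp (- 2 * C * s) * (f s \<bullet> f s)" for s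
  have "\<phi> t \<le> \<phi> 0"
  proof (rule DERIV_nonpos_imp_nonincreasing[OF t(1)])
    fix s assume s: "0 \<le> s" "s \<le> t"
    have d: "((\<lambda>s. f s \<bullet> f s) has_real_derivative 2 * (f s \<bullet> f' s)) (at s)"
      using der[of s] s t unfolding has_vector_derivative_def has_field_derivative_def
      by (auto intro!: derivative_eq_intros simp: inner_commute)
    have "(\<phi> has_real_derivative exp (- 2 * C * s) * (2 * (f s \<bullet> f' s) - 2 * C * (f s \<bullet> f s))) (at s)"
      unfolding \<phi>_def by (auto intro!: derivative_eq_intros d simp: algebra_simps)
    moreover have "f s \<bullet> f' s \<le> C * (f s \<bullet> f s)"
    proof -
      have "f s \<bullet> f' s \<le> norm (f s) * norm (f' s)" by (rule norm_cauchy_schwarz)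
      also have "\<dots> \<le> norm (f s) * (C * norm (f s))" using bound[of s] s t by (intro mult_left_mono) auto
      finally show ?thesis by (simp add: power2_norm_eq_inner[symmetric] power2_eq_square algebra_simps)
    qed
    ultimately show "\<exists>y. DERIV \<phi> s :> y \<and> y \<le> 0"
      by (intro exI[of _ "exp (- 2 * C * s) * (2 * (f s \<bullet> f' s) - 2 * C * (f s \<bullet> f s))"] conjI)
        (auto intro!: mult_nonneg_nonpos)
  qed
  then have "f t \<bullet> f t \<le> 0" by (simp add: \<phi>_def f0 mult_le_0_iff)
  then show ?thesis by (metis inner_ge_zero inner_eq_zero_iff order_antisym)
qed

locale convex_constant_rank = C3_function \<Omega> u for \<Omega> :: "(real^'n) set" and u +
  fixes k :: nat
  assumes convex: "convex_fun_on \<Omega> u" and k_le: "k \<le> CARD('n)"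
    and rank: "\<And>x. x \<in> \<Omega> \<Longrightarrow> rank (hessian u x) = CARD('n) - k"
begin

text \<open>
  Along a line the tangent inequality at two points, used in both directions, shows that the first
  derivative is monotone.
\<close>

lemma hessian_nonneg:
  assumes x: "x \<in> \<Omega>" shows "v \<bullet> (hessian u x *v v) \<ge> 0"
proof -
  define I where "I = {t. x + t *\<^sub>R v \<in> \<Omega>}"
  have "continuous_on UNIV (\<lambda>t. x + t *\<^sub>R v)" by (intro continuous_intros)
  then have "open I" unfolding I_def using open_vimage[OF open_\<Omega>, of "\<lambda>t. x + t *\<^sub>R v"]
    by (simp add: vimage_def)
  moreover have "0 \<in> I" using x by (simp add: I_def)
  ultimately obtain r where r: "r > 0" "ball 0 r \<subseteq> I" using openE by blast
  define g where "g t = u (x + t *\<^sub>R v)" for t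
  define g' where "g' t = dir_deriv v u (x + t *\<^sub>R v)" for t
  have inI: "x + t *\<^sub>R v \<in> \<Omega>" if "t \<in> ball 0 r" for t using that r by (auto simp: I_def)
  have g: "(g has_real_derivative g' t) (at t)" if "t \<in> ball 0 r" for t
    unfolding g_def g'_def by (rule has_real_derivative_along_line[OF along Ck_u(1) _ inI[OF that]]) simp
  have g': "(g' has_real_derivative v \<bullet> (hessian u x *v v)) (at 0)"
    unfolding g'_def using has_real_derivative_along_line[OF along Ck_du(1), of v x 0 v] x
    by (simp add: hessian_inner)
  have "convex ((\<lambda>t. x + t *\<^sub>R v) ` ball 0 r)"
  proof -
    have "(\<lambda>t. x + t *\<^sub>R v) ` ball 0 r = (\<lambda>y. x + y) ` ((\<lambda>t. t *\<^sub>R v) ` ball 0 r)" by auto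
    moreover have "convex ((\<lambda>t. t *\<^sub>R v) ` ball (0::real) r)"
      by (rule convex_linear_image) (auto intro!: linearI simp: algebra_simps)
    ultimately show ?thesis using convex_translation by metis
  qed
  then have cu: "convex_on ((\<lambda>t. x + t *\<^sub>R v) ` ball 0 r) u"
    using convex inI unfolding convex_fun_on_def by (meson image_subsetI)
  have cg: "convex_on (ball 0 r) g"
  proof (rule convex_onI)
    fix t a b :: real assume t: "0 < t" "t < 1" and ab: "a \<in> ball 0 r" "b \<in> ball 0 r"
    have "x + ((1 - t) *\<^sub>R a + t *\<^sub>R b) *\<^sub>R v = (1 - t) *\<^sub>R (x + a *\<^sub>R v) + t *\<^sub>R (x + b *\<^sub>R v)"
      by (simp add: algebra_simps)
    moreover have "x + a *\<^sub>R v \<in> (\<lambda>t. x + t *\<^sub>R v) ` ball 0 r" "x + b *\<^sub>R v \<in> (\<lambda>t. x + t *\<^sub>R v) ` ball 0 r"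
      using ab by blast+
    ultimately show "g ((1 - t) *\<^sub>R a + t *\<^sub>R b) \<le> (1 - t) * g a + t * g b"
      unfolding g_def using convex_onD[OF cu, of t "x + a *\<^sub>R v" "x + b *\<^sub>R v"] t by simp
  qed simp
  have mono: "(g' t - g' 0) / (t - 0) \<ge> 0" if t: "t \<in> ball 0 r" for t
  proof -
    have 0: "0 \<in> ball (0::real) r" using r by simp
    have a: "g t - g 0 \<ge> g' 0 * (t - 0)"
      by (rule convex_on_imp_above_tangent[OF cg _ _ t]) (use g[OF 0] 0 in \<open>auto simp: interior_open intro: has_field_derivative_at_within\<close>)
    have b: "g 0 - g t \<ge> g' t * (0 - t)"
      by (rule convex_on_imp_above_tangent[OF cg _ _ 0]) (use g[OF t] t in \<open>auto simp: interior_open intro: has_field_derivative_at_within\<close>)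
    from a b have "(g' t - g' 0) * t \<ge> 0" by (simp add: algebra_simps)
    then show ?thesis by (simp add: zero_le_divide_iff zero_le_mult_iff)
  qed
  have "((\<lambda>t. (g' t - g' 0) / (t - 0)) \<longlongrightarrow> v \<bullet> (hessian u x *v v)) (at 0)"
    using g' by (simp add: has_field_derivative_iff)
  moreover have "\<forall>\<^sub>F t in at 0. (g' t - g' 0) / (t - 0) \<ge> 0"
    using mono r by (auto simp: eventually_at intro!: exI[of _ r])
  ultimately show ?thesis by (rule tendsto_lowerbound) simp
qed

text \<open>
  On the diagonal, \<open>v \<bullet> H(x + t a) v\<close> is nonnegative and vanishes at \<open>t = 0\<close>, so its derivative in every
  direction \<open>a\<close> is zero; by symmetry that derivative is \<open>((D\<^sub>v H) v) \<bullet> a\<close>. The general case follows by polarization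
  on the subspace of null vectors.
\<close>

lemma hessian_deriv_null:
  assumes x: "x \<in> \<Omega>" and v: "hessian u x *v v = 0" and w: "hessian u x *v w = 0"
  shows "hessian_deriv u x v *v w = 0"
proof -
  have diag: "hessian_deriv u x v *v v = 0" if v: "hessian u x *v v = 0" for v
  proof -
    have "(hessian_deriv u x v *v v) \<bullet> a = 0" for a
    proof -
      define \<phi> where "\<phi> t = v \<bullet> (hessian u (x + t *\<^sub>R a) *v v)" for t
      have "(\<phi> has_vector_derivative v \<bullet> (hessian_deriv u x a *v v)) (at 0)"
        unfolding \<phi>_def using hessian_along_line[of x 0 a] x
        by (intro bounded_linear.has_vector_derivative[OF bounded_linear_inner_right]
             bounded_linear.has_vector_derivative[OF bounded_bilinear.bounded_linear_left[OF bounded_bilinear_matrix_vector_mult]]) simp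
      then have d: "DERIV \<phi> 0 :> v \<bullet> (hessian_deriv u x a *v v)"
        by (simp add: has_real_derivative_iff_has_vector_derivative)
      obtain e where e: "e > 0" "\<And>h. norm h < e \<Longrightarrow> x + h \<in> \<Omega>"
        using along x unfolding open_along_def by auto
      have "v \<bullet> (hessian_deriv u x a *v v) = 0"
      proof (rule DERIV_local_min[OF d])
        show "e / (norm a + 1) > 0" using e by (simp add: add_nonneg_pos)
        show "\<forall>y. \<bar>0 - y\<bar> < e / (norm a + 1) \<longrightarrow> \<phi> 0 \<le> \<phi> y"
        proof (intro allI impI)
          fix y :: real assume "\<bar>0 - y\<bar> < e / (norm a + 1)"
          then have "\<bar>y\<bar> * (norm a + 1) < e" by (simp add: pos_less_divide_eq add_nonneg_pos)
          then have "norm (y *\<^sub>R a) < e" by (simp add: algebra_simps)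
          then have "\<phi> y \<ge> 0" unfolding \<phi>_def by (intro hessian_nonneg e)
          then show "\<phi> 0 \<le> \<phi> y" by (simp add: \<phi>_def v)
        qed
      qed
      then show ?thesis using hessian_deriv_commute[OF x, of a v] Sym_inner[OF hessian_deriv_Sym[OF x], of v v a] by simp
    qed
    then show ?thesis by (metis inner_eq_zero_iff)
  qed
  have "hessian_deriv u x (v + w) *v (v + w) = 0" by (rule diag) (simp add: matrix_vector_right_distrib v w)
  then have "2 *\<^sub>R (hessian_deriv u x v *v w) = 0"
    using diag[OF v] diag[OF w] hessian_deriv_commute[OF x, of w v]
    by (simp add: hessian_deriv_add[OF x] matrix_vector_mult_add_rdistrib matrix_vector_right_distrib scaleR_2)
  then show ?thesis by simp
qed

lemma dim_kernel:
  assumes x: "x \<in> \<Omega>" shows "dim {v. hessian u x *v v = 0} = k"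
proof -
  let ?R = "range ((*v) (hessian u x))"
  have "subspace ?R" by (simp add: linear_subspace_image)
  then have "dim {y \<in> UNIV. \<forall>x\<in>?R. orthogonal x y} + dim ?R = dim (UNIV :: (real^'n) set)"
    by (intro dim_subspace_orthogonal_to_vectors) auto
  moreover have "{y \<in> UNIV. \<forall>x\<in>?R. orthogonal x y} = {v. hessian u x *v v = 0}"
  proof -
    have "(\<forall>w. (hessian u x *v w) \<bullet> v = 0) \<longleftrightarrow> hessian u x *v v = 0" for v
      using Sym_inner[OF hessian_Sym[OF x]] by (metis inner_zero_right inner_eq_zero_iff)
    then show ?thesis by (auto simp: orthogonal_def)
  qed
  ultimately show ?thesis using rank[OF x] k_le by (simp add: rank_dim_range)
qed

end

lemma has_vector_derivative_at_0_iff: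
  assumes "f 0 = 0"
  shows "(f has_vector_derivative D) (at (0::real)) \<longleftrightarrow> ((\<lambda>s. (1 / s) *\<^sub>R f s) \<longlongrightarrow> D) (at 0)"
proof -
  have "(f has_vector_derivative D) (at 0) \<longleftrightarrow> (\<lambda>h. norm (f h - h *\<^sub>R D) / norm h) \<midarrow>0\<rightarrow> 0"
    unfolding has_vector_derivative_def has_derivative_at
    using assms by (simp add: bounded_linear_scaleR_left)
  also have "\<dots> \<longleftrightarrow> (\<lambda>h. norm ((1 / h) *\<^sub>R f h - D)) \<midarrow>0\<rightarrow> 0"
  proof (rule tendsto_cong)
    have "norm (f h - h *\<^sub>R D) / norm h = norm ((1 / h) *\<^sub>R f h - D)" if "h \<noteq> 0" for h
    proof -
      have "(1 / h) *\<^sub>R f h - D = (1 / h) *\<^sub>R (f h - h *\<^sub>R D)"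
        using that by (simp add: scaleR_diff_right)
      then show ?thesis by (simp add: divide_inverse)
    qed
    then show "\<forall>\<^sub>F h in at 0. norm (f h - h *\<^sub>R D) / norm h = norm ((1 / h) *\<^sub>R f h - D)"
      by (auto simp: eventually_at intro!: exI[of _ 1])
  qed
  also have "\<dots> \<longleftrightarrow> (\<lambda>h. (1 / h) *\<^sub>R f h) \<midarrow>0\<rightarrow> D"
    unfolding tendsto_norm_zero_iff by (rule LIM_zero_iff)
  finally show ?thesis .
qed

context convex_constant_rank begin

text \<open>
  The range \<open>E\<close> of \<open>H(x\<^sub>0)\<close> stays complementary to the kernel of \<open>H(x)\<close> for \<open>x\<close> near \<open>x\<^sub>0\<close>: by continuity
  \<open>H(x)\<close> is bounded below on \<open>E\<close>, and the dimensions add up because the rank is constant. The component \<open>e\<close> of \<open>v\<close> in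
  \<open>E\<close> measures how far \<open>v\<close> is from being null at \<open>x\<close>, and it is controlled linearly by \<open>H(x) v\<close>.
\<close>

lemma kernel_complement_uniform:
  assumes x0: "x0 \<in> \<Omega>" and PK: "kernel_split (hessian u x0) P K"
  shows "\<exists>r>0. \<exists>c>0. cball x0 r \<subseteq> \<Omega> \<and> (\<forall>x\<in>cball x0 r. \<forall>v. \<exists>e.
    P *v e = 0 \<and> hessian u x *v (v - e) = 0 \<and> norm e \<le> c * norm (hessian u x *v v))"
proof -
  let ?H = "hessian u"
  note P = PK[unfolded kernel_split_def]
  define E where "E = range ((*v) (?H x0))"
  have E: "subspace E" unfolding E_def by (simp add: linear_subspace_image)
  have PE: "P *v e = 0" if "e \<in> E" for e
    using that P unfolding E_def by (auto simp: matrix_vector_mul_assoc)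
  have "inj ((*v) (?H x0 + P))"
    using P matrix_left_invertible_injective by blast
  then obtain B where B: "B > 0" "\<And>v. B * norm v \<le> norm ((?H x0 + P) *v v)"
    using linear_inj_bounded_below_pos[OF matrix_vector_mul_linear] by blast
  obtain D where D: "D > 0" "\<And>(A::real^'n^'n) (w::real^'n). norm (A *v w) \<le> norm A * norm w * D"
    using bounded_bilinear.pos_bounded[OF bounded_bilinear_matrix_vector_mult] by blast
  obtain d where d: "d > 0" "\<And>x. x \<in> \<Omega> \<Longrightarrow> dist x x0 < d \<Longrightarrow> dist (?H x) (?H x0) < B / (2 * D)"
    using hessian_continuous x0 B(1) D(1) unfolding continuous_on_iff
    by (metis divide_pos_pos mult_pos_pos zero_less_numeral)
  obtain r0 where r0: "r0 > 0" "cball x0 r0 \<subseteq> \<Omega>"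
    using open_\<Omega> x0 open_contains_cball by blast
  define r where "r = min r0 (d / 2)"
  have r: "r > 0" "cball x0 r \<subseteq> \<Omega>" using r0 d by (auto simp: r_def)
  have "\<exists>e. P *v e = 0 \<and> ?H x *v (v - e) = 0 \<and> norm e \<le> (2 / B) * norm (?H x *v v)"
    if x: "x \<in> cball x0 r" for x v
  proof -
    have x': "x \<in> \<Omega>" using x r by blast
    have "dist (?H x) (?H x0) < B / (2 * D)"
      using x d(1) by (intro d x') (simp add: r_def dist_commute)
    then have close: "norm (?H x0 - ?H x) * D \<le> B / 2"
      using D(1) by (simp add: dist_norm norm_minus_commute field_simps)
    have lower: "norm e \<le> (2 / B) * norm (?H x *v e)" if e: "e \<in> E" for e
    proof -
      have "B * norm e \<le> norm (?H x0 *v e)"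
        using B(2)[of e] PE[OF e] by (simp add: matrix_vector_mult_add_rdistrib)
      also have "?H x0 *v e = ?H x *v e + (?H x0 - ?H x) *v e"
        by (simp add: matrix_vector_mult_diff_rdistrib)
      also have "norm \<dots> \<le> norm (?H x *v e) + norm ((?H x0 - ?H x) *v e)" by (rule norm_triangle_ineq)
      also have "norm ((?H x0 - ?H x) *v e) \<le> norm (?H x0 - ?H x) * norm e * D" by (rule D)
      also have "\<dots> \<le> B / 2 * norm e" using mult_right_mono[OF close norm_ge_zero[of e]] by (simp add: mult_ac)
      finally have "B / 2 * norm e \<le> norm (?H x *v e)" by simp
      then show ?thesis using B(1) by (simp add: field_simps)
    qed
    define N where "N = {v. ?H x *v v = 0}"
    have N: "subspace N" unfolding N_def
      by (auto simp: subspace_def matrix_vector_right_distrib matrix_vector_mult_scaleR)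
    have "E \<inter> N = {0}"
      using lower subspace_0[OF E] subspace_0[OF N] by (force simp: N_def)
    then have "dim {a + b |a b. a \<in> E \<and> b \<in> N} = dim E + dim N"
      using dim_sums_Int[OF E N] by simp
    also have "\<dots> = CARD('n)"
      using rank[OF x0] dim_kernel[OF x'] k_le by (simp add: E_def N_def rank_dim_range)
    finally have "{a + b |a b. a \<in> E \<and> b \<in> N} = UNIV"
      using subspace_sums[OF E N] dim_eq_full[of "{a + b |a b. a \<in> E \<and> b \<in> N}"]
      by (simp add: span_eq_iff[THEN iffD2])
    then obtain e b where eb: "v = e + b" "e \<in> E" "b \<in> N" by blast
    then have "?H x *v v = ?H x *v e" by (simp add: N_def matrix_vector_right_distrib)
    then show ?thesis using eb lower[OF eb(2)] PE[OF eb(2)] by (intro exI[of _ e]) (simp add: N_def)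
  qed
  moreover have "2 / B > 0" using B by simp
  ultimately show ?thesis using r by blast
qed

lemma kernel_along_segment:
  assumes seg: "\<And>t. 0 \<le> t \<Longrightarrow> t \<le> 1 \<Longrightarrow> x + t *\<^sub>R y \<in> \<Omega>"
    and bound: "\<And>t. 0 \<le> t \<Longrightarrow> t \<le> 1 \<Longrightarrow>
      norm (hessian_deriv u (x + t *\<^sub>R y) y *v v) \<le> C * norm (hessian u (x + t *\<^sub>R y) *v v)"
    and v: "hessian u x *v v = 0" and t: "0 \<le> t" "t \<le> 1"
  shows "hessian u (x + t *\<^sub>R y) *v v = 0"
  by (rule vanishes_of_derivative_bound[OF _ bound _ t])
     (auto simp: v intro!: hessian_along_line seg
        bounded_linear.has_vector_derivative[OF bounded_bilinear.bounded_linear_left[OF bounded_bilinear_matrix_vector_mult]])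

lemma segment_in_cball:
  fixes v :: "'a::real_normed_vector"
  assumes "x \<in> cball z r" "x + v \<in> cball z r" "0 \<le> t" "t \<le> 1" shows "x + t *\<^sub>R v \<in> cball z r"
proof -
  have "(1 - t) *\<^sub>R x + t *\<^sub>R (x + v) \<in> cball z r"
    using assms convexD_alt[OF convex_cball] by blast
  then show ?thesis by (simp add: algebra_simps)
qed

text \<open>
  Write \<open>v = (v - e) + e\<close> with \<open>v - e\<close> null at the point considered. The term of \<open>(D\<^sub>v H) v\<close> that is quadratic in
  \<open>v - e\<close> vanishes, so \<open>(D\<^sub>v H) v\<close> is bounded by a multiple of \<open>\<bar>e\<bar>\<close> and hence of \<open>\<bar>H v\<bar>\<close>. The
  differential inequality for \<open>H v\<close> along the line then forces \<open>H v = 0\<close>, and \<open>H v\<close> is the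
  derivative of the gradient along the line.
\<close>

lemma flat_leaf:
  assumes sub: "cball x0 r \<subseteq> \<Omega>"
    and split: "\<And>x v. x \<in> cball x0 r \<Longrightarrow> \<exists>e. hessian u x *v (v - e) = 0 \<and> norm e \<le> c * norm (hessian u x *v v)"
    and c: "c > 0"
    and x: "x \<in> cball x0 r" "x + v \<in> cball x0 r" and v: "hessian u x *v v = 0"
  shows "hessian u (x + v) *v v = 0" "gradient u (x + v) = gradient u x"
proof -
  let ?H = "hessian u"
  have seg: "x + t *\<^sub>R v \<in> cball x0 r" if "0 \<le> t" "t \<le> 1" for t
    using segment_in_cball[OF x that] .
  obtain C where C: "C > 0" "\<And>x v w. x \<in> cball x0 r \<Longrightarrow> norm (hessian_deriv u x v *v w) \<le> C * norm v * norm w"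
    using hessian_deriv_bounded_locally[OF compact_cball sub] by blast
  obtain b where b: "\<And>x. x \<in> cball x0 r \<Longrightarrow> norm (?H x *v v) \<le> b"
    using hessian_mult_bounded_locally[OF compact_cball sub] by blast
  have bound: "norm (hessian_deriv u y v *v v) \<le> (C * (2 * norm v + c * b) * c) * norm (?H y *v v)"
    if y: "y \<in> cball x0 r" for y
  proof -
    have y': "y \<in> \<Omega>" using y sub by blast
    obtain e where e: "?H y *v (v - e) = 0" "norm e \<le> c * norm (?H y *v v)" using split[OF y] by blast
    have "hessian_deriv u y (v - e) *v (v - e) = 0" by (rule hessian_deriv_null[OF y' e(1) e(1)])
    then have "hessian_deriv u y v *v v - hessian_deriv u y v *v e - (hessian_deriv u y v *v e - hessian_deriv u y e *v e) = 0"
      using hessian_deriv_commute[OF y', of e v]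
      by (simp add: hessian_deriv_diff[OF y'] matrix_vector_mult_diff_rdistrib matrix_vector_mult_diff_distrib)
    moreover have "hessian_deriv u y (v + v - e) *v e = hessian_deriv u y v *v e + hessian_deriv u y v *v e - hessian_deriv u y e *v e"
      unfolding hessian_deriv_diff[OF y'] hessian_deriv_add[OF y'] matrix_vector_mult_diff_rdistrib matrix_vector_mult_add_rdistrib ..
    moreover have "hessian_deriv u y v *v v = (hessian_deriv u y v *v v - hessian_deriv u y v *v e - (hessian_deriv u y v *v e - hessian_deriv u y e *v e))
        + (hessian_deriv u y v *v e + hessian_deriv u y v *v e - hessian_deriv u y e *v e)" by simp
    ultimately have "hessian_deriv u y v *v v = hessian_deriv u y (v + v - e) *v e" by simp
    then have "norm (hessian_deriv u y v *v v) \<le> C * norm (v + v - e) * norm e" using C(2)[OF y] by simp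
    also have "\<dots> \<le> C * (2 * norm v + c * b) * (c * norm (?H y *v v))"
    proof (intro mult_mono mult_left_mono)
      have "norm (v + v - e) \<le> 2 * norm v + norm e" using norm_triangle_ineq4[of "v + v" e] norm_triangle_ineq[of v v] by linarith
      also have "norm e \<le> c * b" using e(2) b[OF y] c by (meson mult_left_mono order_trans less_imp_le)
      finally show "norm (v + v - e) \<le> 2 * norm v + c * b" by simp
      then show "0 \<le> C * (2 * norm v + c * b)" using C(1) norm_ge_zero[of "v + v - e"]
        by (intro mult_nonneg_nonneg) linarith+
    qed (use C e in auto)
    finally show ?thesis by (simp add: mult_ac)
  qed
  have null: "?H (x + t *\<^sub>R v) *v v = 0" if t: "0 \<le> t" "t \<le> 1" for t
    by (rule kernel_along_segment[OF _ bound[OF seg] v t]) (use seg sub in blast)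
  from null[of 1] show "?H (x + v) *v v = 0" by simp
  have "gradient u (x + 1 *\<^sub>R v) - gradient u x = 0"
    by (rule vanishes_of_derivative_bound[where f' = "\<lambda>_. 0" and C = 0 and f = "\<lambda>t. gradient u (x + t *\<^sub>R v) - gradient u x" and t=1])
      (use gradient_along_line[of x _ v] seg sub null in \<open>auto intro!: derivative_eq_intros simp: subset_iff\<close>)
  then show "gradient u (x + v) = gradient u x" by simp
qed

end

section \<open>The Hessian along a line in a null direction\<close>

lemma tendsto_matrix_vector_mult [tendsto_intros]:
  fixes f :: "'a \<Rightarrow> real^'n^'m"
  assumes "(f \<longlongrightarrow> A) F" "(g \<longlongrightarrow> v) F" shows "((\<lambda>x. f x *v g x) \<longlongrightarrow> A *v v) F"
  using bounded_bilinear.tendsto[OF bounded_bilinear_matrix_vector_mult assms] .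

lemma tendsto_matrix_matrix_mult [tendsto_intros]:
  fixes f :: "'a \<Rightarrow> real^'n^'m" and g :: "'a \<Rightarrow> real^'k^'n"
  assumes "(f \<longlongrightarrow> A) F" "(g \<longlongrightarrow> B) F" shows "((\<lambda>x. f x ** g x) \<longlongrightarrow> A ** B) F"
  using bounded_bilinear.tendsto[OF bounded_bilinear_matrix_matrix_mult assms] .

lemma has_vector_derivative_matrix_vector_mult:
  fixes f :: "real \<Rightarrow> real^'n^'m"
  assumes "(f has_vector_derivative A) F" shows "((\<lambda>x. f x *v v) has_vector_derivative A *v v) F"
  using bounded_linear.has_vector_derivative[OF bounded_bilinear.bounded_linear_left[OF bounded_bilinear_matrix_vector_mult] assms] .

context convex_constant_rank begin

text \<open>
  The range component \<open>e\<close> of the fixed vector \<open>v\<close> at the point \<open>x\<^sub>0 + s z\<close> satisfies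
  \<open>(H(x\<^sub>0) + P) e = H(x\<^sub>0 + s z) v - (H(x\<^sub>0 + s z) - H(x\<^sub>0)) e\<close>. The first term on the right is
  \<open>s (D\<^sub>v H) z\<close> to first order and the second one is of smaller order, because \<open>e\<close> is itself bounded by a
  multiple of the first.
\<close>

lemma split_first_order:
  assumes x0: "x0 \<in> \<Omega>" and PK: "kernel_split (hessian u x0) P K" and v: "hessian u x0 *v v = 0"
    and e: "\<forall>\<^sub>F s in at 0. P *v e s = 0 \<and> hessian u (x0 + s *\<^sub>R z) *v (v - e s) = 0 \<and>
        norm (e s) \<le> c * norm (hessian u (x0 + s *\<^sub>R z) *v v)"
    and e0: "e 0 = 0"
  shows "(e has_vector_derivative (K ** hessian_deriv u x0 v) *v z) (at 0)"
proof -
  let ?H = "\<lambda>s. hessian u (x0 + s *\<^sub>R z)"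
  note P = PK[unfolded kernel_split_def]
  obtain D where D: "D > 0" "\<And>(A::real^'n^'n) (w::real^'n). norm (A *v w) \<le> norm A * norm w * D"
    using bounded_bilinear.pos_bounded[OF bounded_bilinear_matrix_vector_mult] by blast
  have dH: "(?H has_vector_derivative hessian_deriv u x0 z) (at 0)"
    using hessian_along_line[of x0 0 z] x0 by simp
  then have limH: "(?H \<longlongrightarrow> hessian u x0) (at 0)"
    using has_vector_derivative_continuous[OF dH] by (simp add: continuous_at)
  define a where "a s = ?H s *v v" for s
  have "(a has_vector_derivative hessian_deriv u x0 v *v z) (at 0)"
    unfolding a_def hessian_deriv_commute[OF x0, of v z] by (rule has_vector_derivative_matrix_vector_mult[OF dH])
  then have lima: "((\<lambda>s. (1 / s) *\<^sub>R a s) \<longlongrightarrow> hessian_deriv u x0 v *v z) (at 0)"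
    by (subst (asm) has_vector_derivative_at_0_iff) (simp_all add: a_def v)
  define b where "b s = (?H s - hessian u x0) *v e s" for s
  have limb: "((\<lambda>s. (1 / s) *\<^sub>R b s) \<longlongrightarrow> 0) (at 0)"
  proof (rule Lim_null_comparison)
    have "((\<lambda>s. norm (?H s - hessian u x0) * (c * norm ((1 / s) *\<^sub>R a s)) * D)
        \<longlongrightarrow> norm (hessian u x0 - hessian u x0) * (c * norm (hessian_deriv u x0 v *v z)) * D) (at 0)"
      by (intro tendsto_intros limH lima)
    then show "((\<lambda>s. norm (?H s - hessian u x0) * (c * norm ((1 / s) *\<^sub>R a s)) * D) \<longlongrightarrow> 0) (at 0)" by simp
    show "\<forall>\<^sub>F s in at 0. norm ((1 / s) *\<^sub>R b s) \<le> norm (?H s - hessian u x0) * (c * norm ((1 / s) *\<^sub>R a s)) * D"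
      using e
    proof eventually_elim
      case (elim s)
      have "norm (b s) \<le> norm (?H s - hessian u x0) * norm (e s) * D" unfolding b_def by (rule D)
      also have "\<dots> \<le> norm (?H s - hessian u x0) * (c * norm (a s)) * D"
        using elim D(1) by (intro mult_left_mono mult_right_mono) (auto simp: a_def)
      finally have "\<bar>1 / s\<bar> * norm (b s) \<le> \<bar>1 / s\<bar> * (norm (?H s - hessian u x0) * (c * norm (a s)) * D)"
        by (rule mult_left_mono) simp
      then show ?case by (simp add: mult_ac)
    qed
  qed
  have "((\<lambda>s. K *v ((1 / s) *\<^sub>R a s) - K *v ((1 / s) *\<^sub>R b s)) \<longlongrightarrow> K *v (hessian_deriv u x0 v *v z) - K *v 0) (at 0)"
    by (intro tendsto_intros lima limb)
  moreover have "\<forall>\<^sub>F s in at 0. K *v ((1 / s) *\<^sub>R a s) - K *v ((1 / s) *\<^sub>R b s) = (1 / s) *\<^sub>R e s"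
    using e
  proof eventually_elim
    case (elim s)
    have "(hessian u x0 + P) *v e s = a s - b s"
      using elim by (simp add: a_def b_def matrix_vector_mult_add_rdistrib matrix_vector_mult_diff_rdistrib
          matrix_vector_mult_diff_distrib)
    then have "K *v (a s - b s) = e s"
      using P by (metis matrix_vector_mul_assoc matrix_vector_mul_lid)
    then show ?case
      by (metis matrix_vector_mult_diff_distrib matrix_vector_mult_scaleR scaleR_diff_right)
  qed
  ultimately have "((\<lambda>s. (1 / s) *\<^sub>R e s) \<longlongrightarrow> (K ** hessian_deriv u x0 v) *v z) (at 0)"
    by (auto simp: matrix_vector_mul_assoc intro: Lim_transform_eventually)
  then show ?thesis by (simp add: has_vector_derivative_at_0_iff e0)
qed

text \<open>
  Through the point \<open>x\<^sub>0 + s z\<close> passes the line in the null direction \<open>v - e\<close>, where \<open>e\<close> is the range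
  component of \<open>v\<close> there, and the gradient is constant on it. So
  \<open>gradient u (x\<^sub>0 + s z + t (v - e)) = gradient u (x\<^sub>0 + s z)\<close> for small \<open>s\<close> and \<open>t\<close>. Differentiating in \<open>s\<close> at
  \<open>s = 0\<close> for fixed \<open>t\<close> requires only second derivatives of \<open>u\<close> and the first order behaviour of \<open>e\<close>, and gives
  \<open>H(x\<^sub>0 + t v) (z - t K X z) = H(x\<^sub>0) z\<close> with \<open>X = D\<^sub>v H(x\<^sub>0)\<close>.
\<close>

lemma leaf_hessian:
  assumes x0: "x0 \<in> \<Omega>" and PK: "kernel_split (hessian u x0) P K" and v: "hessian u x0 *v v = 0"
  shows "\<exists>\<tau>>0. \<forall>t. \<bar>t\<bar> \<le> \<tau> \<longrightarrow> x0 + t *\<^sub>R v \<in> \<Omega> \<and> hessian u (x0 + t *\<^sub>R v) *v v = 0 \<and>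
     gradient u (x0 + t *\<^sub>R v) = gradient u x0 \<and>
     hessian u (x0 + t *\<^sub>R v) ** (mat 1 - t *\<^sub>R (K ** hessian_deriv u x0 v)) = hessian u x0"
proof -
  let ?H = "hessian u" and ?L = "K ** hessian_deriv u x0 v"
  obtain r c where r: "r > 0" "cball x0 r \<subseteq> \<Omega>" and c: "c > 0" and
    split: "\<And>x v. x \<in> cball x0 r \<Longrightarrow> \<exists>e.
      P *v e = 0 \<and> ?H x *v (v - e) = 0 \<and> norm e \<le> c * norm (?H x *v v)"
    using kernel_complement_uniform[OF x0 PK] by blast
  have leaf: "?H (x + w) *v w = 0" "gradient u (x + w) = gradient u x"
    if "x \<in> cball x0 r" "x + w \<in> cball x0 r" "?H x *v w = 0" for x w
    using flat_leaf[OF r(2) _ c that] split by blast+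
  obtain e where e: "\<And>x. x \<in> cball x0 r \<Longrightarrow>
      P *v e x = 0 \<and> ?H x *v (v - e x) = 0 \<and> norm (e x) \<le> c * norm (?H x *v v)"
    using split[of _ v] by metis
  obtain b where b: "\<And>x. x \<in> cball x0 r \<Longrightarrow> norm (?H x *v v) \<le> b"
    using hessian_mult_bounded_locally[OF compact_cball r(2)] by blast
  have x0r: "x0 \<in> cball x0 r" using r by simp
  have b0: "b \<ge> 0" using b[OF x0r] norm_ge_zero order_trans by blast
  have e0: "e x0 = 0" using e[OF x0r] v by simp
  \<comment> \<open>The number \<open>m\<close> bounds the norm of \<open>v - e x\<close> on the ball, and the summand \<open>1\<close> makes it positive.\<close>
  define m where "m = norm v + c * b + 1"
  have m: "m > 0" using c b0 by (simp add: m_def add_nonneg_pos)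
  define \<tau> where "\<tau> = r / 2 / m"
  have \<tau>: "\<tau> > 0" using r m by (simp add: \<tau>_def)
  have small: "norm (t *\<^sub>R (v - e x)) \<le> r / 2" if t: "\<bar>t\<bar> \<le> \<tau>" and x: "x \<in> cball x0 r" for t x
  proof -
    have "norm (e x) \<le> c * b" using e[OF x] b[OF x] c by (meson mult_left_mono order_trans less_imp_le)
    then have "norm (v - e x) \<le> m" using norm_triangle_ineq4[of v "e x"] by (simp add: m_def)
    then have "\<bar>t\<bar> * norm (v - e x) \<le> \<tau> * m" using t \<tau> by (intro mult_mono) auto
    then show ?thesis using m by (simp add: \<tau>_def)
  qed
  have main: "x0 + t *\<^sub>R v \<in> \<Omega> \<and> ?H (x0 + t *\<^sub>R v) *v v = 0 \<and>
     gradient u (x0 + t *\<^sub>R v) = gradient u x0 \<and> ?H (x0 + t *\<^sub>R v) ** (mat 1 - t *\<^sub>R ?L) = ?H x0" if t: "\<bar>t\<bar> \<le> \<tau>" for t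
  proof -
    have in_ball: "x0 + t *\<^sub>R v \<in> cball x0 r" using small[OF t x0r] e0 r(1) by (simp add: dist_norm)
    then have x1: "x0 + t *\<^sub>R v \<in> \<Omega>" using r by blast
    have null: "?H (x0 + t *\<^sub>R v) *v v = 0"
    proof (cases "t = 0")
      case False
      have "?H (x0 + t *\<^sub>R v) *v (t *\<^sub>R v) = 0"
        by (rule leaf[OF x0r in_ball]) (simp add: v matrix_vector_mult_scaleR)
      then show ?thesis using False by (simp add: matrix_vector_mult_scaleR)
    qed (simp add: v)
    have "?H (x0 + t *\<^sub>R v) *v (z - t *\<^sub>R (?L *v z)) = ?H x0 *v z" for z
    proof -
      define w where "w s = e (x0 + s *\<^sub>R z)" for s
      define \<delta> where "\<delta> = r / (2 * (norm z + 1))"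
      have \<delta>: "\<delta> > 0" using r by (simp add: \<delta>_def add_nonneg_pos)
      have sz: "norm (s *\<^sub>R z) \<le> r / 2" if "\<bar>s\<bar> < \<delta>" for s
      proof -
        have "\<bar>s\<bar> * (2 * (norm z + 1)) < r"
          using that unfolding \<delta>_def by (subst (asm) pos_less_divide_eq) (simp_all add: add_nonneg_pos)
        then show ?thesis by (simp add: algebra_simps)
      qed
      have near: "\<forall>\<^sub>F s in at (0::real). \<bar>s\<bar> < \<delta>"
        using \<delta> by (auto simp: eventually_at intro!: exI[of _ \<delta>])
      have inb: "x0 + s *\<^sub>R z \<in> cball x0 r" if "\<bar>s\<bar> < \<delta>" for s
        using sz[OF that] r(1) by (simp add: dist_norm)
      have dw: "(w has_vector_derivative ?L *v z) (at 0)"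
      proof (rule split_first_order[OF x0 PK v])
        show "\<forall>\<^sub>F s in at 0. P *v w s = 0 \<and> ?H (x0 + s *\<^sub>R z) *v (v - w s) = 0 \<and>
            norm (w s) \<le> c * norm (?H (x0 + s *\<^sub>R z) *v v)"
          using near unfolding w_def by eventually_elim (intro e inb)
        show "w 0 = 0" by (simp add: w_def e0)
      qed
      define \<gamma> where "\<gamma> s = x0 + s *\<^sub>R z + t *\<^sub>R (v - w s)" for s
      have \<gamma>0: "\<gamma> 0 = x0 + t *\<^sub>R v" by (simp add: \<gamma>_def w_def e0)
      have d\<gamma>: "(\<gamma> has_vector_derivative z - t *\<^sub>R (?L *v z)) (at 0)"
        unfolding \<gamma>_def by (auto intro!: derivative_eq_intros dw)
      have dg: "((\<lambda>s. gradient u (\<gamma> s)) has_vector_derivative ?H (\<gamma> 0) *v (z - t *\<^sub>R (?L *v z))) (at 0)"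
        using has_vector_derivative_compose[OF d\<gamma>] has_derivative_gradient x1 unfolding \<gamma>0 by blast
      have eqg: "gradient u (x0 + s *\<^sub>R z) = gradient u (\<gamma> s)" if s: "\<bar>s\<bar> < \<delta>" for s
      proof -
        have 1: "x0 + s *\<^sub>R z + t *\<^sub>R (v - w s) \<in> cball x0 r"
        proof -
          have "norm (s *\<^sub>R z + t *\<^sub>R (v - w s)) \<le> r / 2 + r / 2"
            using sz[OF s] small[OF t inb[OF s]] unfolding w_def by (meson add_mono norm_triangle_le)
          moreover have "x0 - (x0 + s *\<^sub>R z + t *\<^sub>R (v - w s)) = - (s *\<^sub>R z + t *\<^sub>R (v - w s))" by simp
          ultimately show ?thesis by (simp only: mem_cball dist_norm norm_minus_cancel field_sum_of_halves)
        qed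
        have "?H (x0 + s *\<^sub>R z) *v (v - w s) = 0" using e[OF inb[OF s]] unfolding w_def by blast
        then have 2: "?H (x0 + s *\<^sub>R z) *v (t *\<^sub>R (v - w s)) = 0"
          by (simp only: matrix_vector_mult_scaleR scaleR_zero_right)
        show ?thesis unfolding \<gamma>_def by (rule leaf(2)[OF inb[OF s] 1 2, symmetric])
      qed
      have "((\<lambda>s. gradient u (x0 + s *\<^sub>R z)) has_vector_derivative ?H (\<gamma> 0) *v (z - t *\<^sub>R (?L *v z))) (at 0)"
        by (rule has_vector_derivative_transform_within[OF dg \<delta>]) (simp_all add: eqg)
      moreover have "((\<lambda>s. gradient u (x0 + s *\<^sub>R z)) has_vector_derivative ?H x0 *v z) (at 0)"
        using gradient_along_line[of x0 0 z] x0 by simp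
      ultimately show ?thesis unfolding \<gamma>0 by (rule vector_derivative_unique_at)
    qed
    then have "?H (x0 + t *\<^sub>R v) ** (mat 1 - t *\<^sub>R ?L) = ?H x0"
      by (simp add: matrix_eq matrix_vector_mul_assoc[symmetric] matrix_vector_mult_diff_rdistrib scaleR_matrix_vector_assoc[symmetric])
    moreover have "gradient u (x0 + t *\<^sub>R v) = gradient u x0"
      by (rule leaf(2)[OF x0r in_ball]) (simp add: v matrix_vector_mult_scaleR)
    ultimately show ?thesis using x1 null by blast
  qed
  then show ?thesis using \<tau> by blast
qed

text \<open>
  With \<open>D(t) = H(x\<^sub>0 + t v)\<close> and \<open>L = K X\<close>, differentiating \<open>D(t) (1 - t L) = H(x\<^sub>0)\<close> once yields
  \<open>D'(t) = D(t) L + t D'(t) L\<close>. The right hand side can be differentiated at \<open>t = 0\<close> knowing only that \<open>D'\<close> is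
  continuous, and both terms contribute \<open>X L\<close>.
\<close>

lemma leaf_hessian_second_order:
  assumes x0: "x0 \<in> \<Omega>" and PK: "kernel_split (hessian u x0) P K" and v: "hessian u x0 *v v = 0"
  defines "X \<equiv> hessian_deriv u x0 v"
  shows "((\<lambda>t. (1 / t) *\<^sub>R (hessian_deriv u (x0 + t *\<^sub>R v) v - X)) \<longlongrightarrow> X ** K ** X + X ** K ** X) (at 0)"
proof -
  let ?L = "K ** X"
  obtain \<tau> where \<tau>: "\<tau> > 0" and leaf: "\<And>t. \<bar>t\<bar> \<le> \<tau> \<Longrightarrow> x0 + t *\<^sub>R v \<in> \<Omega>"
    "\<And>t. \<bar>t\<bar> \<le> \<tau> \<Longrightarrow> hessian u (x0 + t *\<^sub>R v) ** (mat 1 - t *\<^sub>R ?L) = hessian u x0"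
    using leaf_hessian[OF x0 PK v] unfolding X_def by metis
  define D where "D t = hessian u (x0 + t *\<^sub>R v)" for t
  define D' where "D' t = hessian_deriv u (x0 + t *\<^sub>R v) v" for t
  have dD: "(D has_vector_derivative D' t) (at t)" if "\<bar>t\<bar> \<le> \<tau>" for t
    unfolding D_def D'_def by (rule hessian_along_line[OF leaf(1)[OF that]])
  have D'_eq: "D' t = D t ** ?L + t *\<^sub>R (D' t ** ?L)" if t: "\<bar>t\<bar> < \<tau>" for t
  proof -
    have "((\<lambda>t. D t ** (mat 1 - t *\<^sub>R ?L)) has_vector_derivative
        D t ** (- ?L) + D' t ** (mat 1 - t *\<^sub>R ?L)) (at t)"
      by (rule bounded_bilinear.has_vector_derivative[OF bounded_bilinear_matrix_matrix_mult dD])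
         (use t in \<open>auto intro!: derivative_eq_intros\<close>)
    moreover have "((\<lambda>t. D t ** (mat 1 - t *\<^sub>R ?L)) has_vector_derivative 0) (at t)"
    proof (rule has_vector_derivative_transform_within_open)
      show "((\<lambda>_. hessian u x0) has_vector_derivative 0) (at t)" by simp
      show "open {-\<tau><..<\<tau>}" "t \<in> {-\<tau><..<\<tau>}" using t by auto
      show "hessian u x0 = D s ** (mat 1 - s *\<^sub>R ?L)" if "s \<in> {-\<tau><..<\<tau>}" for s
        using leaf(2)[of s] that by (auto simp: D_def)
    qed
    ultimately have "D t ** (- ?L) + D' t ** (mat 1 - t *\<^sub>R ?L) = 0"
      by (rule vector_derivative_unique_at)
    then have "D' t - t *\<^sub>R (D' t ** ?L) = D t ** ?L" by (simp add: matrix_mult_bilinear)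
    then show ?thesis by (simp only: diff_eq_eq)
  qed
  have X: "X = D 0 ** ?L" using D'_eq[of 0] \<tau> by (simp add: D'_def X_def)
  have "((\<lambda>t. (1 / t) *\<^sub>R (D t - D 0)) \<longlongrightarrow> D' 0) (at 0)"
  proof -
    have "((\<lambda>t. D t - D 0) has_vector_derivative D' 0) (at 0)"
      using dD[of 0] \<tau> by (auto intro!: derivative_eq_intros)
    then show ?thesis by (subst (asm) has_vector_derivative_at_0_iff) auto
  qed
  moreover have "(D' \<longlongrightarrow> D' 0) (at 0)"
  proof -
    have "isCont (\<lambda>x. hessian_deriv u x v) x0"
      using hessian_deriv_continuous x0 open_\<Omega> by (simp add: continuous_on_eq_continuous_at)
    then have "isCont (\<lambda>t. hessian_deriv u (x0 + t *\<^sub>R v) v) 0"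
      by (intro isCont_o2[where f = "\<lambda>t. x0 + t *\<^sub>R v" and g = "\<lambda>x. hessian_deriv u x v"]) (auto intro!: continuous_intros)
    then show ?thesis by (simp add: isCont_def D'_def[abs_def])
  qed
  ultimately have "((\<lambda>t. ((1 / t) *\<^sub>R (D t - D 0)) ** ?L + D' t ** ?L) \<longlongrightarrow> D' 0 ** ?L + D' 0 ** ?L) (at 0)"
    by (intro tendsto_intros)
  moreover have "\<forall>\<^sub>F t in at 0. ((1 / t) *\<^sub>R (D t - D 0)) ** ?L + D' t ** ?L = (1 / t) *\<^sub>R (D' t - X)"
  proof -
    have "\<forall>\<^sub>F t in at (0::real). \<bar>t\<bar> < \<tau> \<and> t \<noteq> 0"
      using \<tau> by (auto simp: eventually_at intro!: exI[of _ \<tau>])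
    then show ?thesis
    proof eventually_elim
      case (elim t)
      have "D' t - X = (D t - D 0) ** ?L + t *\<^sub>R (D' t ** ?L)"
        by (subst X, subst D'_eq) (use elim in \<open>simp_all add: matrix_mult_bilinear\<close>)
      then show ?case using elim by (simp add: matrix_mult_bilinear scaleR_add_right)
    qed
  qed
  ultimately show ?thesis
    by (auto simp: D'_def X_def[symmetric] matrix_mul_assoc intro: Lim_transform_eventually)
qed

end

section \<open>Second derivatives of the operator\<close>

definition jet_tangent :: "'n::finite jet set" where
  "jet_tangent = Sym \<times> UNIV \<times> UNIV \<times> UNIV"

lemma subspace_Sym: "subspace Sym"
  by (auto simp: subspace_def Sym_iff)

lemma open_along_jet_domain:
  assumes "open \<Omega>" shows "open_along (jet_tangent :: 'n::finite jet set) (jet_domain \<Omega>)"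
  unfolding open_along_def
proof (intro conjI ballI)
  show "subspace (jet_tangent :: 'n jet set)"
    unfolding jet_tangent_def by (intro subspace_Times subspace_Sym subspace_UNIV)
  fix z :: "'n jet" assume "z \<in> jet_domain \<Omega>"
  then obtain A p s x where z: "z = (A, p, s, x)" "A \<in> Sym" "x \<in> \<Omega>" by (auto simp: jet_domain_def)
  obtain e where e: "e > 0" "\<And>y. dist y x < e \<Longrightarrow> y \<in> \<Omega>" using assms z(3) by (auto simp: open_dist)
  have "z + h \<in> jet_domain \<Omega>" if h: "h \<in> jet_tangent" "norm h < e" for h
  proof -
    obtain B q r y where hh: "h = (B, q, r, y)" by (cases h)
    have "norm y \<le> norm h" unfolding hh
      by (meson norm_snd_le order_trans)
    then have "x + y \<in> \<Omega>" using h(2) by (intro e) (simp add: dist_norm)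
    then show ?thesis using h(1) z by (simp add: hh jet_domain_def jet_tangent_def Sym_add)
  qed
  then show "\<exists>e>0. \<forall>h\<in>jet_tangent. norm h < e \<longrightarrow> z + h \<in> jet_domain \<Omega>" using e(1) by blast
qed

lemma second_dir_deriv_sum:
  assumes S: "open_along T S" and f: "Ck_on 2 f S" and z: "z \<in> S"
    and h: "\<And>i. i \<in> I \<Longrightarrow> h i \<in> T" and g: "\<And>j. j \<in> J \<Longrightarrow> g j \<in> T"
  shows "dir_deriv (\<Sum>i\<in>I. a i *\<^sub>R h i) (dir_deriv (\<Sum>j\<in>J. b j *\<^sub>R g j) f) z
    = (\<Sum>i\<in>I. \<Sum>j\<in>J. a i * b j * dir_deriv (h i) (dir_deriv (g j) f) z)"
proof -
  have f2: "Ck_on (Suc (Suc 0)) f S" using f by (simp add: numeral_2_eq_2)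
  have T: "subspace T" using S by (simp add: open_along_def)
  have G: "(\<Sum>j\<in>J. b j *\<^sub>R g j) \<in> T" using g T by (intro subspace_sum subspace_scale)
  have "dir_deriv (h i) (dir_deriv (\<Sum>j\<in>J. b j *\<^sub>R g j) f) z
      = (\<Sum>j\<in>J. b j * dir_deriv (h i) (dir_deriv (g j) f) z)" if i: "i \<in> I" for i
  proof -
    have "dir_deriv (h i) (dir_deriv (\<Sum>j\<in>J. b j *\<^sub>R g j) f) z
        = dir_deriv (\<Sum>j\<in>J. b j *\<^sub>R g j) (dir_deriv (h i) f) z"
      by (rule dir_deriv_commute[OF S f h[OF i] G z])
    also have "\<dots> = (\<Sum>j\<in>J. b j * dir_deriv (g j) (dir_deriv (h i) f) z)"
      by (rule dir_deriv_sum[OF S Ck_on_dir_deriv[OF S f2 h[OF i]] z g])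
    also have "\<dots> = (\<Sum>j\<in>J. b j * dir_deriv (h i) (dir_deriv (g j) f) z)"
      by (intro sum.cong refl arg_cong2[where f="(*)"] dir_deriv_commute[OF S f _ _ z] g h i)
    finally show ?thesis .
  qed
  moreover have "dir_deriv (\<Sum>i\<in>I. a i *\<^sub>R h i) (dir_deriv (\<Sum>j\<in>J. b j *\<^sub>R g j) f) z
    = (\<Sum>i\<in>I. a i * dir_deriv (h i) (dir_deriv (\<Sum>j\<in>J. b j *\<^sub>R g j) f) z)"
    by (rule dir_deriv_sum[OF S Ck_on_dir_deriv[OF S f2 G] z h])
  ultimately show ?thesis by (simp add: sum_distrib_left mult.assoc)
qed

text \<open>
  The direction in which \<open>D_mat\<close> differentiates.
\<close>

definition sym_unit :: "'n \<Rightarrow> 'n \<Rightarrow> real^'n^'n" where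
  "sym_unit a b = (1/2) *\<^sub>R (axis a (axis b 1) + axis b (axis a 1))"

lemma sym_unit_Sym: "sym_unit a b \<in> Sym"
  by (auto simp: Sym_iff sym_unit_def axis_def)

lemma Sym_eq_sum_sym_unit:
  assumes X: "X \<in> Sym" shows "X = (\<Sum>a\<in>UNIV. \<Sum>b\<in>UNIV. X $ a $ b *\<^sub>R sym_unit a b)"
proof -
  have 1: "(\<Sum>a\<in>UNIV. \<Sum>b\<in>UNIV. X $ a $ b *\<^sub>R axis a (axis b 1)) = X"
  proof (intro vec_eq_iff[THEN iffD2] allI)
    fix i j
    have "(X $ a $ b *\<^sub>R axis a (axis b 1)) $ i $ j = (if a = i then if b = j then X $ a $ b else 0 else 0)" for a b
      by (simp add: axis_def)
    moreover have "(\<Sum>b\<in>UNIV. if a = i then if b = j then X $ a $ b else 0 else 0) = (if a = i then X $ a $ j else 0)" for a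
      by simp
    ultimately show "(\<Sum>a\<in>UNIV. \<Sum>b\<in>UNIV. X $ a $ b *\<^sub>R axis a (axis b 1)) $ i $ j = X $ i $ j"
      by (simp only: sum_component) simp
  qed
  have "(\<Sum>a\<in>UNIV. \<Sum>b\<in>UNIV. X $ a $ b *\<^sub>R axis b (axis a 1)) = X"
    using X 1 by (subst sum.swap) (simp add: Sym_iff)
  moreover have "X $ a $ b *\<^sub>R sym_unit a b
      = (1/2) *\<^sub>R (X $ a $ b *\<^sub>R axis a (axis b 1) + X $ a $ b *\<^sub>R axis b (axis a 1))" for a b
    by (simp only: sym_unit_def scaleR_left_commute[of _ "1/2"] scaleR_add_right)
  ultimately have "(\<Sum>a\<in>UNIV. \<Sum>b\<in>UNIV. X $ a $ b *\<^sub>R sym_unit a b) = (1/2) *\<^sub>R (X + X)"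
    using 1 by (simp only: scaleR_sum_right[symmetric] sum.distrib)
  also have "\<dots> = X" by (simp only: scaleR_half_double)
  finally show ?thesis ..
qed

lemma sum_UNIV_pair: "(\<Sum>i\<in>UNIV. f i) = (\<Sum>a\<in>UNIV. \<Sum>b\<in>UNIV. f (a, b))"
  for f :: "'a::finite \<times> 'b::finite \<Rightarrow> 'c::comm_monoid_add"
  by (simp add: sum.cartesian_product)

lemma matrix_direction:
  assumes X: "X \<in> Sym"
  shows "(X, 0, 0, 0) = (\<Sum>i\<in>UNIV. X $ fst i $ snd i *\<^sub>R (sym_unit (fst i) (snd i), 0, 0, 0) :: 'n::finite jet)"
proof -
  have pair: "(\<Sum>i\<in>I. (f i, 0, 0, 0)) = ((sum f I, 0, 0, 0) :: 'n jet)" for f :: "'n \<times> 'n \<Rightarrow> real^'n^'n" and I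
    by (induction I rule: infinite_finite_induct) (simp_all add: prod_eq_iff)
  have "X = (\<Sum>i\<in>UNIV. X $ fst i $ snd i *\<^sub>R sym_unit (fst i) (snd i))"
    unfolding sum_UNIV_pair fst_conv snd_conv by (rule Sym_eq_sum_sym_unit[OF X])
  then have "((X, 0, 0, 0) :: 'n jet) = (\<Sum>i\<in>UNIV. X $ fst i $ snd i *\<^sub>R sym_unit (fst i) (snd i), 0, 0, 0)"
    by (rule arg_cong[where f = "\<lambda>A. (A, 0, 0, 0)"])
  also have "\<dots> = (\<Sum>i\<in>UNIV. (X $ fst i $ snd i *\<^sub>R sym_unit (fst i) (snd i), 0, 0, 0))"
    by (rule pair[symmetric])
  also have "\<dots> = (\<Sum>i\<in>UNIV. X $ fst i $ snd i *\<^sub>R (sym_unit (fst i) (snd i), 0, 0, 0))"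
    by (intro sum.cong refl) simp
  finally show ?thesis .
qed

lemma position_direction:
  "(0, 0, 0, v) = (\<Sum>i\<in>UNIV. v $ i *\<^sub>R (0, 0, 0, axis i 1) :: 'n::finite jet)"
proof -
  have pair: "(\<Sum>i\<in>I. (0, 0, 0, f i)) = ((0, 0, 0, sum f I) :: 'n jet)" for f :: "'n \<Rightarrow> real^'n" and I
    by (induction I rule: infinite_finite_induct) (simp_all add: prod_eq_iff)
  have "((0, 0, 0, v) :: 'n jet) = (0, 0, 0, \<Sum>i\<in>UNIV. v $ i *\<^sub>R axis i 1)"
    using vec_axis_sum[of v] by (rule arg_cong[where f = "\<lambda>x. (0, 0, 0, x)"])
  also have "\<dots> = (\<Sum>i\<in>UNIV. (0, 0, 0, v $ i *\<^sub>R axis i 1))"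
    by (rule pair[symmetric])
  also have "\<dots> = (\<Sum>i\<in>UNIV. v $ i *\<^sub>R (0, 0, 0, axis i 1))"
    by (intro sum.cong refl) simp
  finally show ?thesis .
qed

lemma scalar_direction: "(0, 0, c, 0) = (\<Sum>i\<in>{()}. c *\<^sub>R (0, 0, 1, 0) :: 'n::finite jet)"
  by simp

locale jet_function =
  fixes \<Omega> :: "(real^'n) set" and F :: "'n::finite jet \<Rightarrow> real"
  assumes \<Omega>_open: "open \<Omega>" and F2: "Ck_on 2 F (jet_domain \<Omega>)"
begin

lemmas jet_along = open_along_jet_domain[OF \<Omega>_open]

lemma Ck_F: "Ck_on (Suc (Suc 0)) F (jet_domain \<Omega>)" using F2 by (simp add: numeral_2_eq_2)

lemma unit_tangent: "(sym_unit a b, 0, 0, 0) \<in> jet_tangent" "(0, 0, 1, 0) \<in> jet_tangent" "(0, 0, 0, axis a 1) \<in> jet_tangent"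
  "X \<in> Sym \<Longrightarrow> (X, p, s, x) \<in> jet_tangent"
  using subspace_0[OF subspace_Sym] by (auto simp: jet_tangent_def sym_unit_Sym)

lemma D_mat_sum:
  assumes "Ck_on (Suc k) f (jet_domain \<Omega>)" "z \<in> jet_domain \<Omega>" "X \<in> Sym"
  shows "dir_deriv (X, 0, 0, 0) f z = (\<Sum>a\<in>UNIV. \<Sum>b\<in>UNIV. X $ a $ b * D_mat a b f z)"
  unfolding matrix_direction[OF assms(3)]
  by (subst dir_deriv_sum[OF jet_along assms(1,2)])
    (auto simp: unit_tangent D_mat_def sym_unit_def[symmetric] sum_UNIV_pair)

definition second_form :: "'n jet \<Rightarrow> 'n jet \<Rightarrow> real" where
  "second_form z h = dir_deriv h (dir_deriv h F) z"

text \<open>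
  The quadratic form of second derivatives in a direction without gradient component is
  the sum over all pairs of entries, which is how the structural inequality is written. The
  mixed terms appear twice, so symmetry of the second derivatives is used.
\<close>

lemma second_form_expand:
  assumes z: "z \<in> jet_domain \<Omega>" and X: "X \<in> Sym"
  shows "second_form z (X, 0, c, v) =
       (\<Sum>a\<in>UNIV. \<Sum>b\<in>UNIV. \<Sum>r\<in>UNIV. \<Sum>q\<in>UNIV. D_mat a b (D_mat r q F) z * X $ a $ b * X $ r $ q)
     + (\<Sum>a\<in>UNIV. \<Sum>b\<in>UNIV. D_pos a (D_pos b F) z * v $ a * v $ b)
     + 2 * (\<Sum>a\<in>UNIV. \<Sum>b\<in>UNIV. D_mat a b (D_scal F) z * X $ a $ b * c)
     + 2 * (\<Sum>a\<in>UNIV. \<Sum>b\<in>UNIV. \<Sum>r\<in>UNIV. D_mat a b (D_pos r F) z * X $ a $ b * v $ r)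
     + 2 * (\<Sum>a\<in>UNIV. D_scal (D_pos a F) z * c * v $ a)
     + D_scal (D_scal F) z * c\<^sup>2"
proof -
  let ?q = "\<lambda>h g. dir_deriv h (dir_deriv g F) z"
  let ?X = "(X, 0, 0, 0) :: 'n jet" and ?c = "(0, 0, c, 0) :: 'n jet" and ?v = "(0, 0, 0, v) :: 'n jet"
  have 0: "0 \<in> Sym" by (rule subspace_0[OF subspace_Sym])
  have T: "?X \<in> jet_tangent" "?c \<in> jet_tangent" "?v \<in> jet_tangent" using X 0 by (auto simp: jet_tangent_def)
  have sT: "subspace (jet_tangent :: 'n jet set)" using jet_along by (simp add: open_along_def)
  have com: "?q h g = ?q g h" if "h \<in> jet_tangent" "g \<in> jet_tangent" for h g
    by (rule dir_deriv_commute[OF jet_along F2 that z])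
  have addl: "?q (h + h') g = ?q h g + ?q h' g" if "h \<in> jet_tangent" "h' \<in> jet_tangent" "g \<in> jet_tangent" for h h' g
    by (rule dir_deriv_add[OF jet_along Ck_on_dir_deriv[OF jet_along Ck_F that(3)] z that(1,2)])
  have addr: "?q g (h + h') = ?q g h + ?q g h'" if "h \<in> jet_tangent" "h' \<in> jet_tangent" "g \<in> jet_tangent" for h h' g
    unfolding com[OF that(3) subspace_add[OF sT that(1,2)]] com[OF that(3,1)] com[OF that(3,2)] by (rule addl[OF that])
  have "second_form z (X, 0, c, v) = ?q (?X + (?c + ?v)) (?X + (?c + ?v))" by (simp add: second_form_def)
  also have "\<dots> = ?q ?X ?X + ?q ?v ?v + 2 * ?q ?X ?c + 2 * ?q ?X ?v + 2 * ?q ?c ?v + ?q ?c ?c"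
  proof -
    note T' = subspace_add[OF sT T(2,3)] subspace_add[OF sT T(1) subspace_add[OF sT T(2,3)]]
    show ?thesis
      unfolding addl[OF T(1) T'(1) T'(2)] addl[OF T(2,3) T'(2)] addr[OF T(1) T'(1) T(1)] addr[OF T(1) T'(1) T(2)]
        addr[OF T(1) T'(1) T(3)] addr[OF T(2,3) T(1)] addr[OF T(2,3) T(2)] addr[OF T(2,3) T(3)]
        com[OF T(2,1)] com[OF T(3,1)] com[OF T(3,2)] by simp
  qed
  finally have split: "second_form z (X, 0, c, v) = ?q ?X ?X + ?q ?v ?v + 2 * ?q ?X ?c + 2 * ?q ?X ?v + 2 * ?q ?c ?v + ?q ?c ?c" .
  have XX: "?q ?X ?X = (\<Sum>a\<in>UNIV. \<Sum>b\<in>UNIV. \<Sum>r\<in>UNIV. \<Sum>q\<in>UNIV. D_mat a b (D_mat r q F) z * X $ a $ b * X $ r $ q)"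
    unfolding matrix_direction[OF X]
    by (subst second_dir_deriv_sum[OF jet_along F2 z])
      (auto simp: unit_tangent D_mat_def sym_unit_def[symmetric] sum_UNIV_pair mult_ac)
  have VV: "?q ?v ?v = (\<Sum>a\<in>UNIV. \<Sum>b\<in>UNIV. D_pos a (D_pos b F) z * v $ a * v $ b)"
    unfolding position_direction[of v]
    by (subst second_dir_deriv_sum[OF jet_along F2 z]) (auto simp: unit_tangent D_pos_def mult_ac)
  have XC: "?q ?X ?c = (\<Sum>a\<in>UNIV. \<Sum>b\<in>UNIV. D_mat a b (D_scal F) z * X $ a $ b * c)"
    unfolding matrix_direction[OF X] scalar_direction[of c]
    by (subst second_dir_deriv_sum[OF jet_along F2 z])
      (auto simp: unit_tangent D_mat_def D_scal_def sym_unit_def[symmetric] sum_UNIV_pair mult_ac)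
  have XV: "?q ?X ?v = (\<Sum>a\<in>UNIV. \<Sum>b\<in>UNIV. \<Sum>r\<in>UNIV. D_mat a b (D_pos r F) z * X $ a $ b * v $ r)"
    unfolding matrix_direction[OF X] position_direction[of v]
    by (subst second_dir_deriv_sum[OF jet_along F2 z])
      (auto simp: unit_tangent D_mat_def D_pos_def sym_unit_def[symmetric] sum_UNIV_pair mult_ac)
  have CV: "?q ?c ?v = (\<Sum>a\<in>UNIV. D_scal (D_pos a F) z * c * v $ a)"
    unfolding position_direction[of v] scalar_direction[of c]
    by (subst second_dir_deriv_sum[OF jet_along F2 z]) (auto simp: unit_tangent D_scal_def D_pos_def mult_ac)
  have CC: "?q ?c ?c = D_scal (D_scal F) z * c\<^sup>2"
    unfolding scalar_direction[of c]
    by (subst second_dir_deriv_sum[OF jet_along F2 z]) (auto simp: unit_tangent D_scal_def power2_eq_square mult_ac)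
  show ?thesis unfolding split XX VV XC XV CV CC ..
qed

lemma continuous_second_form: "h \<in> jet_tangent \<Longrightarrow> continuous_on (jet_domain \<Omega>) (\<lambda>z. second_form z h)"
  using Ck_on_dir_deriv[OF jet_along Ck_on_dir_deriv[OF jet_along Ck_F], of h h] by (simp add: second_form_def)

lemma Ck_D_mat: "Ck_on (Suc 0) (D_mat a b F) (jet_domain \<Omega>)"
  unfolding D_mat_def sym_unit_def[symmetric] by (rule Ck_on_dir_deriv[OF jet_along Ck_F unit_tangent(1)])

lemma continuous_D_mat: "continuous_on (jet_domain \<Omega>) (D_mat a b F)"
  using Ck_on_SucD[OF Ck_D_mat] by simp

end

section \<open>Differentiating the equation twice along a leaf\<close>

text \<open>
  The assumption \<open>strict\<close> is the structural inequality for the direction \<open>(X, 0, c, v)\<close>, that is with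
  \<open>Z = - v\<close> and \<open>Y = - c\<close>. Its first order term is the derivative of \<open>F\<close> in the direction \<open>2 X A\<^sup>-\<^sup>1 X\<close>,
  which is the second derivative at \<open>t = 0\<close> of the curve of matrices with inverse \<open>A\<^sup>-\<^sup>1 - t A\<^sup>-\<^sup>1 X A\<^sup>-\<^sup>1\<close>.
\<close>

locale degenerate_solution = convex_constant_rank \<Omega> u k + jet_function \<Omega> F
  for \<Omega> :: "(real^'n::finite) set" and u k F +
  fixes \<eta> :: "real^'n \<Rightarrow> real"
  assumes \<eta>_pos: "x \<in> \<Omega> \<Longrightarrow> \<eta> x > 0"
    and strict: "A \<in> Sym_pos \<Longrightarrow> x \<in> \<Omega> \<Longrightarrow> X \<in> Sym \<Longrightarrow>
      \<eta> x * (\<Sum>a\<in>UNIV. \<Sum>b\<in>UNIV. (X $ a $ b)\<^sup>2) \<le> second_form (A, p, s, x) (X, 0, c, v)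
        + 2 * (\<Sum>a\<in>UNIV. \<Sum>b\<in>UNIV. (X ** matrix_inv A ** X) $ a $ b * D_mat a b F (A, p, s, x))"
    and equation: "x \<in> \<Omega> \<Longrightarrow> F (hessian u x, gradient u x, u x, x) = 0"
begin

definition jet :: "real^'n \<Rightarrow> 'n jet" where
  "jet x = (hessian u x, gradient u x, u x, x)"

lemma jet_in_domain: "x \<in> \<Omega> \<Longrightarrow> jet x \<in> jet_domain \<Omega>"
  by (simp add: jet_def jet_domain_def hessian_Sym)

text \<open>
  Along \<open>x\<^sub>0 + t v\<close> the gradient is constant and \<open>u\<close> is affine, so only the Hessian can vary nonlinearly. The first
  derivative of the equation says that \<open>F\<close> has derivative zero in the direction \<open>(D'(t), 0, c, v)\<close> with \<open>D'(t) = D\<^sub>v H(x\<^sub>0 + t v)\<close>.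
  Splitting off the constant direction \<open>\<xi> = (X, 0, c, v)\<close> and dividing by \<open>t\<close>, the two parts tend to
  the second derivative of \<open>F\<close> in direction \<open>\<xi>\<close> and to the derivative of \<open>F\<close> in direction \<open>2 X K X\<close>.
\<close>

lemma equation_along_leaf:
  assumes x0: "x0 \<in> \<Omega>" and PK: "kernel_split (hessian u x0) P K" and v: "hessian u x0 *v v = 0"
  defines "X \<equiv> hessian_deriv u x0 v"
  shows "second_form (jet x0) (X, 0, gradient u x0 \<bullet> v, v)
    + 2 * (\<Sum>a\<in>UNIV. \<Sum>b\<in>UNIV. (X ** K ** X) $ a $ b * D_mat a b F (jet x0)) = 0"
proof -
  let ?c = "gradient u x0 \<bullet> v"
  define \<xi> where "\<xi> = (X, 0 :: real^'n, ?c, v)"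
  define D' where "D' t = hessian_deriv u (x0 + t *\<^sub>R v) v" for t
  define \<zeta> where "\<zeta> t = jet (x0 + t *\<^sub>R v)" for t
  obtain \<tau> where \<tau>: "\<tau> > 0" and leaf: "\<And>t. \<bar>t\<bar> \<le> \<tau> \<Longrightarrow> x0 + t *\<^sub>R v \<in> \<Omega>"
    "\<And>t. \<bar>t\<bar> \<le> \<tau> \<Longrightarrow> hessian u (x0 + t *\<^sub>R v) *v v = 0"
    "\<And>t. \<bar>t\<bar> \<le> \<tau> \<Longrightarrow> gradient u (x0 + t *\<^sub>R v) = gradient u x0"
    using leaf_hessian[OF x0 PK v] by metis
  have XS: "X \<in> Sym" unfolding X_def by (rule hessian_deriv_Sym[OF x0])
  have D'S: "D' t \<in> Sym" if "\<bar>t\<bar> \<le> \<tau>" for t unfolding D'_def by (rule hessian_deriv_Sym[OF leaf(1)[OF that]])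
  have \<zeta>S: "\<zeta> t \<in> jet_domain \<Omega>" if "\<bar>t\<bar> \<le> \<tau>" for t
    unfolding \<zeta>_def by (rule jet_in_domain[OF leaf(1)[OF that]])
  have near: "\<forall>\<^sub>F s in nhds t. \<bar>s\<bar> < \<tau>" if "\<bar>t\<bar> < \<tau>" for t
    by (rule order_tendstoD(2)[OF _ that]) (intro tendsto_intros filterlim_ident)
  have d\<zeta>: "(\<zeta> has_vector_derivative (D' t, 0, ?c, v)) (at t)" if t: "\<bar>t\<bar> \<le> \<tau>" for t
  proof -
    have "((\<lambda>t. gradient u (x0 + t *\<^sub>R v)) has_vector_derivative 0) (at t)"
      using gradient_along_line[OF leaf(1)[OF t]] leaf(2)[OF t] by simp
    moreover have "((\<lambda>t. u (x0 + t *\<^sub>R v)) has_vector_derivative ?c) (at t)"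
      using u_along_line[OF leaf(1)[OF t]] leaf(3)[OF t] by simp
    moreover have "((\<lambda>t. x0 + t *\<^sub>R v) has_vector_derivative v) (at t)"
      by (auto intro!: derivative_eq_intros)
    ultimately show ?thesis
      unfolding \<zeta>_def jet_def D'_def
      by (intro has_vector_derivative_Pair hessian_along_line[OF leaf(1)[OF t]])
  qed
  have \<xi>T: "\<xi> \<in> jet_tangent" unfolding \<xi>_def by (rule unit_tangent(4)[OF XS])
  have first: "dir_deriv \<xi> F (\<zeta> t) = - (\<Sum>a\<in>UNIV. \<Sum>b\<in>UNIV. (D' t - X) $ a $ b * D_mat a b F (\<zeta> t))"
    if t: "\<bar>t\<bar> < \<tau>" for t
  proof -
    have t': "\<bar>t\<bar> \<le> \<tau>" using t by simp
    have ev: "\<forall>\<^sub>F s in nhds t. \<zeta> s \<in> jet_domain \<Omega>"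
      using near[OF t] by eventually_elim (simp add: \<zeta>S)
    have T: "(D' t, 0, ?c, v) \<in> jet_tangent" by (rule unit_tangent(4)[OF D'S[OF t']])
    have "((\<lambda>t. F (\<zeta> t)) has_real_derivative dir_deriv (D' t, 0, ?c, v) F (\<zeta> t)) (at t)"
      by (rule has_real_derivative_along_curve[OF jet_along Ck_F d\<zeta>[OF t'] T ev])
    moreover have "((\<lambda>t. F (\<zeta> t)) has_real_derivative 0) (at t)"
    proof -
      have "\<forall>\<^sub>F s in nhds t. F (\<zeta> s) = 0"
        using near[OF t] by eventually_elim (simp add: \<zeta>_def jet_def equation leaf(1))
      then show ?thesis by (subst DERIV_cong_ev[OF refl _ refl, of _ "\<lambda>_. 0"]) auto
    qed
    ultimately have "0 = dir_deriv (D' t, 0, ?c, v) F (\<zeta> t)" using DERIV_unique by blast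
    also have "(D' t, 0, ?c, v) = \<xi> + (D' t - X, 0, 0, 0)" by (simp add: \<xi>_def)
    also have "dir_deriv (\<xi> + (D' t - X, 0, 0, 0)) F (\<zeta> t)
        = dir_deriv \<xi> F (\<zeta> t) + dir_deriv (D' t - X, 0, 0, 0) F (\<zeta> t)"
      by (rule dir_deriv_add[OF jet_along Ck_F \<zeta>S[OF t'] \<xi>T])
         (rule unit_tangent(4), rule subspace_diff[OF subspace_Sym D'S[OF t'] XS])
    also have "dir_deriv (D' t - X, 0, 0, 0) F (\<zeta> t)
        = (\<Sum>a\<in>UNIV. \<Sum>b\<in>UNIV. (D' t - X) $ a $ b * D_mat a b F (\<zeta> t))"
      by (rule D_mat_sum[OF Ck_F \<zeta>S[OF t'] subspace_diff[OF subspace_Sym D'S[OF t'] XS]])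
    finally show ?thesis by simp
  qed
  have ev0: "\<forall>\<^sub>F s in nhds 0. \<zeta> s \<in> jet_domain \<Omega>"
    using near[of 0] \<tau> by (auto elim!: eventually_mono simp: \<zeta>S)
  have \<zeta>0: "\<zeta> 0 = jet x0" and D'0: "D' 0 = X" by (simp_all add: \<zeta>_def D'_def X_def)
  have d\<zeta>0: "(\<zeta> has_vector_derivative \<xi>) (at 0)" using d\<zeta>[of 0] \<tau> by (simp add: \<xi>_def D'0)
  have "((\<lambda>t. dir_deriv \<xi> F (\<zeta> t)) has_real_derivative second_form (jet x0) \<xi>) (at 0)"
    using has_real_derivative_along_curve[OF jet_along Ck_on_dir_deriv[OF jet_along Ck_F \<xi>T] d\<zeta>0 \<xi>T ev0]
    by (simp add: \<zeta>0 second_form_def)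
  moreover have "dir_deriv \<xi> F (\<zeta> 0) = 0" using first[of 0] \<tau> by (simp add: D'0)
  ultimately have lim1: "((\<lambda>t. (1 / t) *\<^sub>R dir_deriv \<xi> F (\<zeta> t)) \<longlongrightarrow> second_form (jet x0) \<xi>) (at 0)"
    by (subst has_vector_derivative_at_0_iff[symmetric]) (simp_all add: has_real_derivative_iff_has_vector_derivative)
  have cont: "((\<lambda>t. D_mat a b F (\<zeta> t)) \<longlongrightarrow> D_mat a b F (jet x0)) (at 0)" for a b
    using DERIV_isCont[OF has_real_derivative_along_curve[OF jet_along Ck_D_mat d\<zeta>0 \<xi>T ev0]]
    by (simp add: isCont_def \<zeta>0)
  have "((\<lambda>t. - (\<Sum>a\<in>UNIV. \<Sum>b\<in>UNIV. ((1 / t) *\<^sub>R (D' t - X)) $ a $ b * D_mat a b F (\<zeta> t))) \<longlongrightarrow>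
      - (\<Sum>a\<in>UNIV. \<Sum>b\<in>UNIV. (X ** K ** X + X ** K ** X) $ a $ b * D_mat a b F (jet x0))) (at 0)"
    unfolding D'_def X_def
    by (intro tendsto_intros tendsto_vec_nth leaf_hessian_second_order[OF x0 PK v] cont)
  moreover have "\<forall>\<^sub>F t in at 0. - (\<Sum>a\<in>UNIV. \<Sum>b\<in>UNIV. ((1 / t) *\<^sub>R (D' t - X)) $ a $ b * D_mat a b F (\<zeta> t))
      = (1 / t) *\<^sub>R dir_deriv \<xi> F (\<zeta> t)"
  proof -
    have "\<forall>\<^sub>F t in at (0::real). \<bar>t\<bar> < \<tau>"
      using \<tau> by (auto simp: eventually_at intro!: exI[of _ \<tau>])
    then show ?thesis
      by eventually_elim (simp add: first sum_distrib_left divide_inverse mult_ac sum_divide_distrib)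
  qed
  ultimately have "((\<lambda>t. (1 / t) *\<^sub>R dir_deriv \<xi> F (\<zeta> t)) \<longlongrightarrow>
      - (\<Sum>a\<in>UNIV. \<Sum>b\<in>UNIV. (X ** K ** X + X ** K ** X) $ a $ b * D_mat a b F (jet x0))) (at 0)"
    by (rule Lim_transform_eventually)
  with lim1 have "second_form (jet x0) \<xi> = - (\<Sum>a\<in>UNIV. \<Sum>b\<in>UNIV. (X ** K ** X + X ** K ** X) $ a $ b * D_mat a b F (jet x0))"
    using tendsto_unique trivial_limit_at by blast
  also have "\<dots> = - (2 * (\<Sum>a\<in>UNIV. \<Sum>b\<in>UNIV. (X ** K ** X) $ a $ b * D_mat a b F (jet x0)))"
    by (simp add: sum_distrib_left mult.assoc)
  finally show ?thesis by (simp add: \<xi>_def)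
qed

text \<open>
  \<open>X = D\<^sub>v H(x\<^sub>0)\<close> annihilates the kernel of \<open>H(x\<^sub>0)\<close>, so \<open>X (H(x\<^sub>0) + \<epsilon> P)\<^sup>-\<^sup>1 X = X K X\<close> for every \<open>\<epsilon> > 0\<close>. Hence
  the right hand side of the structural inequality at \<open>H(x\<^sub>0) + \<epsilon> P\<close> depends on \<open>\<epsilon>\<close> only through the point
  at which the derivatives of \<open>F\<close> are taken, and it tends to the expression which the twice
  differentiated equation shows to be zero.
\<close>

lemma hessian_deriv_kernel_zero:
  assumes x0: "x0 \<in> \<Omega>" and v: "hessian u x0 *v v = 0"
  shows "hessian_deriv u x0 v = 0"
proof -
  let ?H = "hessian u x0" and ?X = "hessian_deriv u x0 v" and ?c = "gradient u x0 \<bullet> v"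
  obtain P K where PK: "kernel_split ?H P K" using kernel_split_exists[OF hessian_Sym[OF x0]] by blast
  note P = PK[unfolded kernel_split_def]
  let ?S = "\<lambda>z. \<Sum>a\<in>UNIV. \<Sum>b\<in>UNIV. (?X ** K ** ?X) $ a $ b * D_mat a b F z"
  have XS: "?X \<in> Sym" by (rule hessian_deriv_Sym[OF x0])
  have XP: "?X ** P = 0"
  proof -
    have "?H *v (P *v w) = 0" for w using P by (simp add: matrix_vector_mul_assoc)
    then have "?X *v (P *v w) = 0" for w by (rule hessian_deriv_null[OF x0 v])
    then show ?thesis by (simp add: matrix_eq matrix_vector_mul_assoc[symmetric])
  qed
  define z where "z \<epsilon> = (?H + \<epsilon> *\<^sub>R P, gradient u x0, u x0, x0)" for \<epsilon>
  have zS: "z \<epsilon> \<in> jet_domain \<Omega>" for \<epsilon>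
    using x0 P by (simp add: z_def jet_domain_def Sym_add Sym_scaleR hessian_Sym)
  have z0: "z 0 = jet x0" by (simp add: z_def jet_def)
  have limz: "(z \<longlongrightarrow> z 0) (at_right 0)"
    unfolding z_def by (intro tendsto_intros)
  have T: "(?X, 0, ?c, v) \<in> jet_tangent" by (rule unit_tangent(4)[OF XS])
  have lim: "((\<lambda>\<epsilon>. second_form (z \<epsilon>) (?X, 0, ?c, v) + 2 * ?S (z \<epsilon>)) \<longlongrightarrow> second_form (z 0) (?X, 0, ?c, v) + 2 * ?S (z 0)) (at_right 0)"
    by (intro tendsto_intros continuous_on_tendsto_compose[OF continuous_second_form[OF T] limz]
        continuous_on_tendsto_compose[OF continuous_D_mat limz]) (simp_all add: zS)
  have zero: "second_form (z 0) (?X, 0, ?c, v) + 2 * ?S (z 0) = 0"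
    unfolding z0 by (rule equation_along_leaf[OF x0 PK v])
  have ineq: "\<eta> x0 * (\<Sum>a\<in>UNIV. \<Sum>b\<in>UNIV. (?X $ a $ b)\<^sup>2) \<le> second_form (z \<epsilon>) (?X, 0, ?c, v) + 2 * ?S (z \<epsilon>)"
    if \<epsilon>: "\<epsilon> > 0" for \<epsilon>
  proof -
    note inv = kernel_split_inverse[OF hessian_Sym[OF x0] hessian_nonneg[OF x0] PK \<epsilon>]
    have "?X ** matrix_inv (?H + \<epsilon> *\<^sub>R P) ** ?X = ?X ** K ** ?X"
      unfolding inv(2) by (simp add: XP bounded_bilinear.add_right[OF bounded_bilinear_matrix_matrix_mult]
          bounded_bilinear.scaleR_right[OF bounded_bilinear_matrix_matrix_mult])
    then show ?thesis
      using strict[OF inv(1) x0 XS, of "gradient u x0" "u x0" ?c v] by (simp add: z_def)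
  qed
  have "\<eta> x0 * (\<Sum>a\<in>UNIV. \<Sum>b\<in>UNIV. (?X $ a $ b)\<^sup>2) \<le> 0"
    by (rule tendsto_lowerbound[OF lim[unfolded zero]])
       (auto intro!: eventually_at_rightI[of 0 1] ineq)
  then have "(\<Sum>a\<in>UNIV. \<Sum>b\<in>UNIV. (?X $ a $ b)\<^sup>2) \<le> 0"
    using \<eta>_pos[OF x0] by (simp add: mult_le_0_iff)
  then have "(\<Sum>a\<in>UNIV. \<Sum>b\<in>UNIV. (?X $ a $ b)\<^sup>2) = 0"
    by (intro antisym sum_nonneg) auto
  then have "?X $ a $ b = 0" for a b
    by (simp add: sum_nonneg_eq_0_iff sum_nonneg)
  then show ?thesis by (simp add: vec_eq_iff)
qed

text \<open>
  For \<open>v\<close> null at \<open>x\<^sub>0\<close> and \<open>e\<close> its range component at a nearby point \<open>y\<close>, the null part \<open>v - e\<close> contributes nothing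
  to the derivative of \<open>H v\<close> in any direction, because \<open>D\<^sub>w H = 0\<close> for \<open>w = v - e\<close>. So this derivative is bounded
  by a multiple of \<open>\<bar>e\<bar>\<close>, hence of \<open>\<bar>H v\<bar>\<close>, and \<open>H v\<close> remains zero. This gives one inclusion between the kernels; the equality of their
  dimensions gives the other.
\<close>

lemma kernel_locally_constant:
  assumes x0: "x0 \<in> \<Omega>"
  shows "\<forall>\<^sub>F x in at x0 within \<Omega>. {v. hessian u x0 *v v = 0} = {v. hessian u x *v v = 0}"
proof -
  obtain P K where PK: "kernel_split (hessian u x0) P K" using kernel_split_exists[OF hessian_Sym[OF x0]] by blast
  obtain r c where r: "r > 0" "cball x0 r \<subseteq> \<Omega>" and c: "c > 0" and
    split: "\<And>x v. x \<in> cball x0 r \<Longrightarrow> \<exists>e.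
      P *v e = 0 \<and> hessian u x *v (v - e) = 0 \<and> norm e \<le> c * norm (hessian u x *v v)"
    using kernel_complement_uniform[OF x0 PK] by blast
  obtain C where C: "C > 0" "\<And>x v w. x \<in> cball x0 r \<Longrightarrow> norm (hessian_deriv u x v *v w) \<le> C * norm v * norm w"
    using hessian_deriv_bounded_locally[OF compact_cball r(2)] by blast
  have "{v. hessian u x0 *v v = 0} = {v. hessian u x *v v = 0}" if x: "x \<in> cball x0 r" for x
  proof (rule subspace_dim_equal)
    have "subspace {v. hessian u y *v v = 0}" for y
      by (auto simp: subspace_def matrix_vector_right_distrib matrix_vector_mult_scaleR)
    then show "subspace {v. hessian u x0 *v v = 0}" "subspace {v. hessian u x *v v = 0}" by blast+
    have x': "x \<in> \<Omega>" using x r by blast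
    show "dim {v. hessian u x0 *v v = 0} \<ge> dim {v. hessian u x *v v = 0}"
      by (simp add: dim_kernel x0 x')
    show "{v. hessian u x0 *v v = 0} \<subseteq> {v. hessian u x *v v = 0}"
    proof safe
      fix v assume v: "hessian u x0 *v v = 0"
      have seg: "x0 + t *\<^sub>R (x - x0) \<in> cball x0 r" if "0 \<le> t" "t \<le> 1" for t
        by (rule segment_in_cball[OF _ _ that]) (use x r in auto)
      have "norm (hessian_deriv u y (x - x0) *v v) \<le> (C * norm (x - x0) * c) * norm (hessian u y *v v)"
        if y: "y \<in> cball x0 r" for y
      proof -
        have y': "y \<in> \<Omega>" using y r by blast
        obtain e where e: "hessian u y *v (v - e) = 0" "norm e \<le> c * norm (hessian u y *v v)"
          using split[OF y] by blast
        have "hessian_deriv u y v = hessian_deriv u y e"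
          using hessian_deriv_kernel_zero[OF y' e(1)] by (simp add: hessian_deriv_diff[OF y'])
        then have "hessian_deriv u y (x - x0) *v v = hessian_deriv u y (x - x0) *v e"
          by (metis hessian_deriv_commute[OF y'])
        then have "norm (hessian_deriv u y (x - x0) *v v) \<le> C * norm (x - x0) * norm e" using C(2)[OF y] by simp
        also have "\<dots> \<le> C * norm (x - x0) * (c * norm (hessian u y *v v))"
          using e(2) C(1) by (intro mult_left_mono) auto
        finally show ?thesis by (simp add: mult_ac)
      qed
      note bound = this
      have "hessian u (x0 + 1 *\<^sub>R (x - x0)) *v v = 0"
        by (rule kernel_along_segment[where C = "C * norm (x - x0) * c"])
           (use seg r bound v in \<open>auto simp del: mem_cball\<close>)
      then show "hessian u x *v v = 0" by simp
    qed
  qed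
  then show ?thesis
    unfolding eventually_at by (intro exI[of _ r] conjI r(1) ballI impI) (simp add: dist_commute)
qed

end

section \<open>Constancy of the null directions\<close>

lemma sum_first_order_term:
  fixes X B :: "real^'n::finite^'n"
  assumes X: "X \<in> Sym"
  shows "(\<Sum>a\<in>UNIV. \<Sum>b\<in>UNIV. \<Sum>r\<in>UNIV. \<Sum>q\<in>UNIV. G a r * B $ b $ q * X $ a $ b * X $ r $ q)
    = (\<Sum>a\<in>UNIV. \<Sum>r\<in>UNIV. (X ** B ** X) $ a $ r * G a r)"
proof -
  have "(\<Sum>b\<in>UNIV. \<Sum>r\<in>UNIV. \<Sum>q\<in>UNIV. G a r * B $ b $ q * X $ a $ b * X $ r $ q)
      = (\<Sum>r\<in>UNIV. (X ** B ** X) $ a $ r * G a r)" for a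
  proof -
    have "(\<Sum>b\<in>UNIV. \<Sum>q\<in>UNIV. G a r * B $ b $ q * X $ a $ b * X $ r $ q) = (X ** B ** X) $ a $ r * G a r" for r
    proof -
    have "(X ** B ** X) $ a $ r = (\<Sum>q\<in>UNIV. \<Sum>b\<in>UNIV. X $ a $ b * B $ b $ q * X $ r $ q)"
      using X by (simp add: matrix_matrix_mult_def sum_distrib_right Sym_iff)
    also have "\<dots> = (\<Sum>b\<in>UNIV. \<Sum>q\<in>UNIV. X $ a $ b * B $ b $ q * X $ r $ q)" by (rule sum.swap)
    finally show ?thesis by (simp add: sum_distrib_left mult_ac)
    qed
    then show ?thesis by (subst sum.swap) simp
  qed
  then show ?thesis by simp
qed

lemma subspace_contains_indexed_basis:
  fixes N :: "'a::euclidean_space set"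
  assumes "k \<le> dim N"
  shows "\<exists>X :: nat \<Rightarrow> 'a. inj_on X {1..k} \<and> independent (X ` {1..k}) \<and> X ` {1..k} \<subseteq> N"
proof -
  obtain B where B: "B \<subseteq> N" "independent B" "card B = dim N"
    using basis_exists[of N] by metis
  then obtain C where C: "C \<subseteq> B" "card C = k"
    using assms obtain_subset_with_card_n[of k B] by metis
  have "finite C" using C(1) B(2) finite_subset independent_imp_finite by blast
  then obtain X where "bij_betw X {1..k} C"
    using ex_bij_betw_nat_finite_1[of C] C(2) by blast
  then show ?thesis
    using B C independent_mono[OF B(2) C(1)] by (intro exI[of _ X]) (auto simp: bij_betw_def)
qed

theorem theorem3p1:
  fixes \<Omega> :: "(real^'n) set"
    and F :: "'n::finite jet \<Rightarrow> real"
    and \<eta> :: "real^'n \<Rightarrow> real"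
    and u :: "real^'n \<Rightarrow> real"
    and k :: nat
  assumes "open \<Omega>" and "connected \<Omega>"
    and "Ck_on 2 F (jet_domain \<Omega>)"
    and "continuous_on \<Omega> \<eta>" and "\<forall>x\<in>\<Omega>. \<eta> x > 0"
    and "\<And>A p s x X Z Y. A \<in> Sym_pos \<Longrightarrow> x \<in> \<Omega> \<Longrightarrow> X \<in> Sym \<Longrightarrow>
      \<eta> x * (\<Sum>a\<in>UNIV. \<Sum>b\<in>UNIV. (X$a$b)\<^sup>2) \<le>
          (\<Sum>a\<in>UNIV. \<Sum>b\<in>UNIV. \<Sum>r\<in>UNIV. \<Sum>q\<in>UNIV.
             D_mat a b (D_mat r q F) (A, p, s, x) * X$a$b * X$r$q)
        + 2 * (\<Sum>a\<in>UNIV. \<Sum>b\<in>UNIV. \<Sum>r\<in>UNIV. \<Sum>q\<in>UNIV.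
             D_mat a r F (A, p, s, x) * matrix_inv A $b$q * X$a$b * X$r$q)
        + (\<Sum>a\<in>UNIV. \<Sum>b\<in>UNIV. D_pos a (D_pos b F) (A, p, s, x) * Z$a * Z$b)
        - 2 * (\<Sum>a\<in>UNIV. \<Sum>b\<in>UNIV. D_mat a b (D_scal F) (A, p, s, x) * X$a$b * Y)
        - 2 * (\<Sum>a\<in>UNIV. \<Sum>b\<in>UNIV. \<Sum>r\<in>UNIV.
             D_mat a b (D_pos r F) (A, p, s, x) * X$a$b * Z$r)
        + 2 * (\<Sum>a\<in>UNIV. D_scal (D_pos a F) (A, p, s, x) * Y * Z$a)
        + D_scal (D_scal F) (A, p, s, x) * Y\<^sup>2"
    and "Ck_on 3 u \<Omega>" and "convex_fun_on \<Omega> u"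
    and "\<forall>x\<in>\<Omega>. F (hessian u x, gradient u x, u x, x) = 0"
    and "\<forall>x\<in>\<Omega>. (\<chi> i j. D_mat i j F (hessian u x, gradient u x, u x, x)) \<in> Sym_pos"
    and "k \<le> CARD('n)" and "\<forall>x\<in>\<Omega>. rank (hessian u x) = CARD('n) - k"
  shows "\<exists>X :: nat \<Rightarrow> real^'n.
           inj_on X {1..k} \<and> independent (X ` {1..k}) \<and>
           (\<forall>j\<in>{1..k}. \<forall>x\<in>\<Omega>. hessian u x *v X j = 0)"
proof -
  interpret convex_constant_rank \<Omega> u k
    by unfold_locales (use assms(1,7,8,11,12) in auto)
  interpret jet_function \<Omega> F
    by unfold_locales (use assms(1,3) in auto)
  interpret degenerate_solution \<Omega> u k F \<eta>
  proof unfold_locales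
    show "\<eta> x > 0" if "x \<in> \<Omega>" for x using assms(5) that by blast
    show "F (hessian u x, gradient u x, u x, x) = 0" if "x \<in> \<Omega>" for x using assms(9) that by blast
    fix A :: "real^'n^'n" and p :: "real^'n" and s c :: real and x v :: "real^'n" and X :: "real^'n^'n"
    assume A: "A \<in> Sym_pos" and x: "x \<in> \<Omega>" and X: "X \<in> Sym"
    have z: "(A, p, s, x) \<in> jet_domain \<Omega>" using A x by (simp add: jet_domain_def Sym_pos_def)
    show "\<eta> x * (\<Sum>a\<in>UNIV. \<Sum>b\<in>UNIV. (X $ a $ b)\<^sup>2) \<le> second_form (A, p, s, x) (X, 0, c, v)
        + 2 * (\<Sum>a\<in>UNIV. \<Sum>b\<in>UNIV. (X ** matrix_inv A ** X) $ a $ b * D_mat a b F (A, p, s, x))"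
      using assms(6)[OF A x X, of p s "- v" "- c"]
      unfolding second_form_expand[OF z X] sum_first_order_term[OF X]
      by (simp add: sum_negf)
  qed
  show ?thesis
  proof (cases "\<Omega> = {}")
    case True
    then show ?thesis
      using subspace_contains_indexed_basis[of k "UNIV :: (real^'n) set"] assms(11) by auto
  next
    case False
    then obtain x0 where x0: "x0 \<in> \<Omega>" by blast
    have kernel: "{v. hessian u x0 *v v = 0} = {v. hessian u x *v v = 0}" if "x \<in> \<Omega>" for x
      by (rule connected_local_const[OF assms(2) x0 that]) (use kernel_locally_constant in blast)
    obtain X :: "nat \<Rightarrow> real^'n" where X: "inj_on X {1..k}" "independent (X ` {1..k})"
      "X ` {1..k} \<subseteq> {v. hessian u x0 *v v = 0}"
      using subspace_contains_indexed_basis[of k "{v. hessian u x0 *v v = 0}"] dim_kernel[OF x0] by auto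
    have "hessian u x *v X j = 0" if "j \<in> {1..k}" "x \<in> \<Omega>" for j x
      using X(3) that kernel[OF that(2)] by blast
    with X(1,2) show ?thesis by blast
  qed
qed

end
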